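(* Let $(M^n,g)$ be a Riemannian manifold and let $E$ be a distribution of rank $r$ on $M$, with orthogonal complement $E^\perp\subset TM$ with respect to $g$. Then there is a unique affine connection $\nabla$ on $M$ that is compatible with $g$ and whose torsion tensor $\tau$ satisfies the following properties for all $X,Y\in\Gamma(E)$ and all $\xi,\eta\in\Gamma(E^\perp)$: (1) $\tau(X,Y)=0$ and $\tau(\xi,\eta)=0$; (2) $g(\tau(\xi,X),Y)=\frac12 (L_\xi g)(X,Y)$; (3) $g(\tau(\xi,X),\eta)=-\frac12 (L_X g)(\xi,\eta)$.
   Context: A distribution of rank $r$ on a smooth manifold $M^n$ is a smooth vector subbundle $E$ of $TM$ of rank $r$. $\Gamma(\cdot)$ denotes the space of smooth sections, and $L$ denotes the Lie derivative. An affine connection $\nabla$ on $M$ is a connection on $TM$; it is compatible with $g$ if $\nabla g=0$. Its torsion tensor is $\tau(X,Y)=\nabla_XY-\nabla_YX-[X,Y]$ for $X,Y\in\Gamma(TM)$, a smooth section of $\mathrm{Hom}(\wedge^2TM,TM)$. *)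

theory Defs
  imports "HOL-Analysis.Analysis" "HOL-Library.Function_Algebras"
begin

section \<open>Pointwise vector space structure on functions\<close>

text \<open>Ring operations on functions are the pointwise ones of the imported library theory; the
  following makes functions a real vector space, so that \<^const>\<open>subspace\<close>, \<^const>\<open>span\<close>
  and \<^const>\<open>independent\<close> apply to tangent vectors.\<close>

instantiation "fun" :: (type, real_vector) real_vector
begin

definition scaleR_fun_def: "c *\<^sub>R f = (\<lambda>x. c *\<^sub>R f x)"

instance
  by standard (auto simp: scaleR_fun_def fun_eq_iff scaleR_add_left scaleR_add_right)

end


section \<open>Smooth maps between open subsets of normed spaces\<close>

text \<open>\<open>Ck_on k f S\<close> is meant for open \<open>S\<close> in a finite-dimensional domain: all directional
  derivatives of order at most \<open>k\<close> exist and are continuous.\<close>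

primrec Ck_on ::
  "nat \<Rightarrow> ('e::real_normed_vector \<Rightarrow> 'f::real_normed_vector) \<Rightarrow> 'e set \<Rightarrow> bool" where
  "Ck_on 0 f S \<longleftrightarrow> continuous_on S f"
| "Ck_on (Suc k) f S \<longleftrightarrow>
     (\<forall>x\<in>S. f differentiable (at x)) \<and> (\<forall>v. Ck_on k (\<lambda>x. frechet_derivative f (at x) v) S)"

definition smooth_on ::
  "('e::real_normed_vector \<Rightarrow> 'f::real_normed_vector) \<Rightarrow> 'e set \<Rightarrow> bool" where
  "smooth_on f S \<longleftrightarrow> (\<forall>k. Ck_on k f S)"


section \<open>Smooth manifolds\<close>

text \<open>The underlying topological space of the manifold is the whole type \<open>'m\<close>, which is Hausdorff
  and second countable; its dimension is \<open>DIM('e)\<close>. The smooth structure is given by some smooth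
  atlas, which need not be maximal.\<close>

type_synonym ('m, 'e) atlas = "('m set \<times> ('m \<Rightarrow> 'e)) set"

definition chart :: "'m::topological_space set \<Rightarrow> ('m \<Rightarrow> 'e::euclidean_space) \<Rightarrow> bool" where
  "chart U \<phi> \<longleftrightarrow> open U \<and> open (\<phi> ` U) \<and> homeomorphism U (\<phi> ` U) \<phi> (inv_into U \<phi>)"

definition smooth_atlas ::
  "('m::{t2_space, second_countable_topology}, 'e::euclidean_space) atlas \<Rightarrow> bool" where
  "smooth_atlas A \<longleftrightarrow>
     (\<forall>(U, \<phi>)\<in>A. chart U \<phi>) \<and> (\<Union>(U, \<phi>)\<in>A. U) = UNIV \<and>
     (\<forall>(U, \<phi>)\<in>A. \<forall>(V, \<psi>)\<in>A. smooth_on (\<psi> \<circ> inv_into U \<phi>) (\<phi> ` (U \<inter> V)))"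

definition smooth_fun_on ::
  "('m::topological_space, 'e::euclidean_space) atlas \<Rightarrow> 'm set \<Rightarrow> ('m \<Rightarrow> real) \<Rightarrow> bool" where
  "smooth_fun_on A W f \<longleftrightarrow> (\<forall>(U, \<phi>)\<in>A. smooth_on (f \<circ> inv_into U \<phi>) (\<phi> ` (U \<inter> W)))"

definition C_inf :: "('m::topological_space, 'e::euclidean_space) atlas \<Rightarrow> ('m \<Rightarrow> real) set" where
  "C_inf A = {f. smooth_fun_on A UNIV f}"


section \<open>Tangent vectors and vector fields\<close>

text \<open>Tangent vectors at \<open>p\<close> are the derivations at \<open>p\<close> of the algebra of smooth functions.
  Being total functions on \<open>'m \<Rightarrow> real\<close>, they are normalised to vanish on non-smooth functions,
  so that equality of tangent vectors is equality in HOL.\<close>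

type_synonym 'm tvec = "('m \<Rightarrow> real) \<Rightarrow> real"
type_synonym 'm vfield = "'m \<Rightarrow> 'm tvec"

definition tangent_space ::
  "('m::topological_space, 'e::euclidean_space) atlas \<Rightarrow> 'm \<Rightarrow> 'm tvec set" where
  "tangent_space A p =
     {v. (\<forall>f\<in>C_inf A. \<forall>h\<in>C_inf A. v (f + h) = v f + v h) \<and>
         (\<forall>f\<in>C_inf A. \<forall>c. v (c *\<^sub>R f) = c * v f) \<and>
         (\<forall>f\<in>C_inf A. \<forall>h\<in>C_inf A. v (f * h) = f p * v h + h p * v f) \<and>
         (\<forall>f. f \<notin> C_inf A \<longrightarrow> v f = 0)}"

text \<open>Smooth sections over an open set \<open>U\<close> of a family \<open>E\<close> of subspaces of the tangent spaces;
  values outside \<open>U\<close> are irrelevant.\<close>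

definition local_sections ::
  "('m::topological_space, 'e::euclidean_space) atlas \<Rightarrow> ('m \<Rightarrow> 'm tvec set) \<Rightarrow> 'm set
     \<Rightarrow> 'm vfield set" where
  "local_sections A E U =
     {X. (\<forall>p\<in>U. X p \<in> E p) \<and> (\<forall>f\<in>C_inf A. smooth_fun_on A U (\<lambda>p. X p f))}"

definition sections ::
  "('m::topological_space, 'e::euclidean_space) atlas \<Rightarrow> ('m \<Rightarrow> 'm tvec set) \<Rightarrow> 'm vfield set" where
  "sections A E = local_sections A E UNIV"

abbreviation vector_fields ::
  "('m::topological_space, 'e::euclidean_space) atlas \<Rightarrow> 'm vfield set" where
  "vector_fields A \<equiv> sections A (tangent_space A)"

definition vf_apply :: "'m vfield \<Rightarrow> ('m \<Rightarrow> real) \<Rightarrow> 'm \<Rightarrow> real" where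
  "vf_apply X f = (\<lambda>p. X p f)"

definition vf_scale :: "('m \<Rightarrow> real) \<Rightarrow> 'm vfield \<Rightarrow> 'm vfield"  (infixr \<open>\<odot>\<close> 75) where
  "f \<odot> X = (\<lambda>p. f p *\<^sub>R X p)"

definition lie_bracket :: "'m vfield \<Rightarrow> 'm vfield \<Rightarrow> 'm vfield" where
  "lie_bracket X Y = (\<lambda>p f. X p (vf_apply Y f) - Y p (vf_apply X f))"


section \<open>Riemannian metrics and distributions\<close>

type_synonym 'm metric_tensor = "'m \<Rightarrow> 'm tvec \<Rightarrow> 'm tvec \<Rightarrow> real"

definition metric_pair :: "'m metric_tensor \<Rightarrow> 'm vfield \<Rightarrow> 'm vfield \<Rightarrow> 'm \<Rightarrow> real" where
  "metric_pair g X Y = (\<lambda>p. g p (X p) (Y p))"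

definition riemannian_metric ::
  "('m::topological_space, 'e::euclidean_space) atlas \<Rightarrow> 'm metric_tensor \<Rightarrow> bool" where
  "riemannian_metric A g \<longleftrightarrow>
     (\<forall>p. \<forall>u\<in>tangent_space A p. \<forall>v\<in>tangent_space A p.
        g p u v = g p v u \<and>
        (\<forall>w\<in>tangent_space A p. g p (u + v) w = g p u w + g p v w) \<and>
        (\<forall>c. g p (c *\<^sub>R u) v = c * g p u v)) \<and>
     (\<forall>p. \<forall>u\<in>tangent_space A p. u \<noteq> 0 \<longrightarrow> g p u u > 0) \<and>
     (\<forall>U. open U \<longrightarrow>
        (\<forall>X\<in>local_sections A (tangent_space A) U. \<forall>Y\<in>local_sections A (tangent_space A) U.
           smooth_fun_on A U (metric_pair g X Y)))"

text \<open>A smooth subbundle of rank \<open>r\<close> of the tangent bundle: around every point the fibres have a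
  basis of \<open>r\<close> smooth local sections.\<close>

definition distribution ::
  "('m::topological_space, 'e::euclidean_space) atlas \<Rightarrow> nat \<Rightarrow> ('m \<Rightarrow> 'm tvec set) \<Rightarrow> bool" where
  "distribution A r E \<longleftrightarrow>
     (\<forall>p. subspace (E p) \<and> E p \<subseteq> tangent_space A p) \<and>
     (\<forall>p. \<exists>U. open U \<and> p \<in> U \<and>
        (\<exists>X :: nat \<Rightarrow> 'm vfield. (\<forall>i<r. X i \<in> local_sections A E U) \<and>
           (\<forall>q\<in>U. inj_on (\<lambda>i. X i q) {..<r} \<and> independent ((\<lambda>i. X i q) ` {..<r}) \<and>
                  span ((\<lambda>i. X i q) ` {..<r}) = E q)))"

definition orth_complement ::
  "('m::topological_space, 'e::euclidean_space) atlas \<Rightarrow> 'm metric_tensor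
     \<Rightarrow> ('m \<Rightarrow> 'm tvec set) \<Rightarrow> 'm \<Rightarrow> 'm tvec set" where
  "orth_complement A g E p = {v \<in> tangent_space A p. \<forall>w\<in>E p. g p v w = 0}"

text \<open>The Lie derivative of the metric, as given by the extension of \<open>L\<^sub>Z f = Z f\<close> and
  \<open>L\<^sub>Z X = [Z, X]\<close> to a derivation of tensor fields commuting with contractions.\<close>

definition lie_deriv_metric ::
  "'m metric_tensor \<Rightarrow> 'm vfield \<Rightarrow> 'm vfield \<Rightarrow> 'm vfield \<Rightarrow> 'm \<Rightarrow> real" where
  "lie_deriv_metric g Z X Y =
     vf_apply Z (metric_pair g X Y)
       - metric_pair g (lie_bracket Z X) Y - metric_pair g X (lie_bracket Z Y)"


section \<open>Affine connections\<close>

type_synonym 'm connection = "'m vfield \<Rightarrow> 'm vfield \<Rightarrow> 'm vfield"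

text \<open>\<open>D X Y\<close> is the covariant derivative of \<open>Y\<close> along \<open>X\<close>. Real homogeneity in \<open>Y\<close> is the Leibniz
  rule for constant \<open>f\<close>. The last clause normalises the values on arguments that are not smooth
  vector fields, so that equality of connections is equality in HOL.\<close>

definition affine_connection ::
  "('m::topological_space, 'e::euclidean_space) atlas \<Rightarrow> 'm connection \<Rightarrow> bool" where
  "affine_connection A D \<longleftrightarrow>
     (\<forall>X\<in>vector_fields A. \<forall>Y\<in>vector_fields A. D X Y \<in> vector_fields A) \<and>
     (\<forall>X\<in>vector_fields A. \<forall>X'\<in>vector_fields A. \<forall>Y\<in>vector_fields A.
        D (X + X') Y = D X Y + D X' Y) \<and>
     (\<forall>f\<in>C_inf A. \<forall>X\<in>vector_fields A. \<forall>Y\<in>vector_fields A. D (f \<odot> X) Y = f \<odot> D X Y) \<and>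
     (\<forall>X\<in>vector_fields A. \<forall>Y\<in>vector_fields A. \<forall>Y'\<in>vector_fields A.
        D X (Y + Y') = D X Y + D X Y') \<and>
     (\<forall>f\<in>C_inf A. \<forall>X\<in>vector_fields A. \<forall>Y\<in>vector_fields A.
        D X (f \<odot> Y) = (vf_apply X f \<odot> Y) + (f \<odot> D X Y)) \<and>
     (\<forall>X Y. X \<notin> vector_fields A \<or> Y \<notin> vector_fields A \<longrightarrow> D X Y = 0)"

definition cov_deriv_metric ::
  "'m metric_tensor \<Rightarrow> 'm connection \<Rightarrow> 'm vfield \<Rightarrow> 'm vfield \<Rightarrow> 'm vfield \<Rightarrow> 'm \<Rightarrow> real" where
  "cov_deriv_metric g D Z X Y =
     vf_apply Z (metric_pair g X Y) - metric_pair g (D Z X) Y - metric_pair g X (D Z Y)"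

definition metric_compatible ::
  "('m::topological_space, 'e::euclidean_space) atlas \<Rightarrow> 'm metric_tensor \<Rightarrow> 'm connection \<Rightarrow> bool" where
  "metric_compatible A g D \<longleftrightarrow>
     (\<forall>Z\<in>vector_fields A. \<forall>X\<in>vector_fields A. \<forall>Y\<in>vector_fields A. cov_deriv_metric g D Z X Y = 0)"

definition torsion :: "'m connection \<Rightarrow> 'm vfield \<Rightarrow> 'm vfield \<Rightarrow> 'm vfield" where
  "torsion D X Y = D X Y - D Y X - lie_bracket X Y"

end

theory Submission
  imports Defs
begin

text \<open>
  Why the theorem holds. A metric connection is determined by its torsion: in the Koszul formula for
  \<open>2 g(D X Y, Z)\<close> one only has to replace every bracket \<open>[X, Y]\<close> by \<open>[X, Y] + \<tau>(X, Y)\<close>. Compatibility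
  and the prescribed torsion give six linear equations, from which this formula follows, so the
  connection is unique; conversely the right-hand side is \<open>C\<^sup>\<infinity>\<close>-linear in \<open>Z\<close>, hence is \<open>2 g(W, Z)\<close>
  for a smooth field \<open>W\<close>, and \<open>W =: D X Y\<close> is a connection. Thus for any \<open>C\<^sup>\<infinity>\<close>-trilinear \<open>\<Theta>\<close> that is
  antisymmetric in its first two arguments there is exactly one metric connection with
  \<open>g(\<tau>(X, Y), Z) = \<Theta> X Y Z\<close> (\<open>ex1_metric_connection_with_torsion\<close>).

  It remains to see that the conditions of the theorem say the same as such an equation
  (\<open>torsion_conditions_iff\<close>). Split all fields into their components along \<open>E\<close> and its orthogonal
  complement. By antisymmetry the conditions prescribe every component of the torsion, so they leave no
  freedom. They can be satisfied because the prescribed values are tensorial: \<open>L\<^sub>\<xi> g\<close> is in general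
  not \<open>C\<^sup>\<infinity>\<close>-linear in \<open>\<xi>\<close>, but the error terms contain the factors \<open>g(\<xi>, X)\<close> and \<open>g(\<xi>, Y)\<close>, which vanish for
  \<open>\<xi>\<close> normal and \<open>X\<close>, \<open>Y\<close> tangential (\<open>mixed_torsion_scale\<close>).

  Two analytic facts carry this algebra. The components of a smooth field are smooth: around each
  point a distribution has an orthogonal frame of smooth sections (\<open>orthogonal_frame\<close>), in which the
  projection is a Fourier expansion. And a \<open>C\<^sup>\<infinity>\<close>-linear functional on fields is represented by a field
  (\<open>riesz\<close>). The second one needs a frame of the whole tangent bundle, so that derivations at
  a point must be known to be combinations of coordinate derivatives (\<open>coordinate_expansion\<close>); this
  rests on Hadamard's lemma and on smooth cutoff functions, since tangent vectors act on globally
  defined functions only.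
\<close>

section \<open>Calculus of \<open>k\<close> times continuously differentiable maps\<close>

lemma Ck_on_subset:
  assumes "Ck_on k f S" "T \<subseteq> S"
  shows "Ck_on k f T"
  using assms by (induction k arbitrary: f) (auto intro: continuous_on_subset)

lemma Ck_on_cong:
  assumes "open S" "\<And>x. x \<in> S \<Longrightarrow> f x = g x" "Ck_on k f S"
  shows "Ck_on k g S"
  using assms(2,3)
proof (induction k arbitrary: f g)
  case 0
  then show ?case using continuous_on_cong[of S S f g] by simp
next
  case (Suc k)
  have D: "(g has_derivative frechet_derivative f (at x)) (at x)" if "x \<in> S" for x
    using Suc.prems that assms(1)
    by (auto intro!: has_derivative_transform_within_open[of f _ x UNIV S g]
        simp: frechet_derivative_works)
  have "Ck_on k (\<lambda>x. frechet_derivative g (at x) v) S" for v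
    by (rule Suc.IH[of "\<lambda>x. frechet_derivative f (at x) v"])
      (use Suc.prems D frechet_derivative_at in \<open>fastforce+\<close>)
  then show ?case using D by (auto simp: differentiable_def)
qed

text \<open>With this rule a closed form \<open>f'\<close> of the derivative can replace \<open>frechet_derivative\<close>, and the
  closure properties below become inductions on \<open>k\<close> in which \<open>f'\<close> is built from functions that are
  already covered.\<close>

lemma Ck_on_SucI:
  assumes "open S" "\<And>x. x \<in> S \<Longrightarrow> (f has_derivative f' x) (at x)" "\<And>v. Ck_on k (\<lambda>x. f' x v) S"
  shows "Ck_on (Suc k) f S"
proof -
  have "Ck_on k (\<lambda>x. frechet_derivative f (at x) v) S" for v
    by (rule Ck_on_cong[OF assms(1) _ assms(3)[of v]]) (use assms(2) frechet_derivative_at in fastforce)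
  then show ?thesis using assms(2) by (auto simp: differentiable_def)
qed

lemma Ck_on_Suc_has_derivative:
  assumes "Ck_on (Suc k) f S" "x \<in> S"
  shows "(f has_derivative frechet_derivative f (at x)) (at x)"
  using assms by (auto simp: frechet_derivative_works)

lemma Ck_on_SucD: "Ck_on (Suc k) f S \<Longrightarrow> Ck_on k f S"
proof (induction k arbitrary: f)
  case 0
  then show ?case
    by (auto simp: continuous_on_eq_continuous_within
        intro: differentiable_imp_continuous_within[THEN continuous_within_subset])
next
  case (Suc k)
  then show ?case by simp
qed

lemma Ck_on_imp_continuous_on: "Ck_on k f S \<Longrightarrow> continuous_on S f"
  by (induction k) (use Ck_on_SucD in auto)

lemma Ck_on_const: "Ck_on k (\<lambda>x. c) S"
  by (induction k arbitrary: c) auto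

lemma Ck_on_bounded_linear:
  assumes "open S" "bounded_linear L" "Ck_on k f S"
  shows "Ck_on k (\<lambda>x. L (f x)) S"
  using assms(3)
proof (induction k arbitrary: f)
  case 0
  then show ?case using assms(2) by (simp add: bounded_linear.continuous_on)
next
  case (Suc k)
  have "Ck_on k (\<lambda>x. L (frechet_derivative f (at x) v)) S" for v
    by (rule Suc.IH) (use Suc.prems in auto)
  then show ?case
    by (rule Ck_on_SucI[OF assms(1), rotated])
      (rule bounded_linear.has_derivative[OF assms(2) Ck_on_Suc_has_derivative[OF Suc.prems]])
qed

lemma Ck_on_id: "open S \<Longrightarrow> Ck_on k (\<lambda>x. x) S"
  by (cases k) (auto intro!: Ck_on_SucI Ck_on_const)

lemma Ck_on_add:
  assumes "open S" "Ck_on k f S" "Ck_on k g S"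
  shows "Ck_on k (\<lambda>x. f x + g x) S"
  using assms(2,3)
proof (induction k arbitrary: f g)
  case 0
  then show ?case by (auto intro: continuous_intros)
next
  case (Suc k)
  have "Ck_on k (\<lambda>x. frechet_derivative f (at x) v + frechet_derivative g (at x) v) S" for v
    by (rule Suc.IH) (use Suc.prems in auto)
  with has_derivative_add[OF Ck_on_Suc_has_derivative[OF Suc.prems(1)]
      Ck_on_Suc_has_derivative[OF Suc.prems(2)]]
  show ?case by (rule Ck_on_SucI[OF assms(1)])
qed

lemma Ck_on_mult:
  fixes f g :: "'a::real_normed_vector \<Rightarrow> real"
  assumes "open S" "Ck_on k f S" "Ck_on k g S"
  shows "Ck_on k (\<lambda>x. f x * g x) S"
  using assms(2,3)
proof (induction k arbitrary: f g)
  case 0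
  then show ?case by (auto intro: continuous_intros)
next
  case (Suc k)
  have "Ck_on k (\<lambda>x. f x * frechet_derivative g (at x) v + frechet_derivative f (at x) v * g x) S" for v
    by (intro Ck_on_add[OF assms(1)] Suc.IH Ck_on_SucD[OF Suc.prems(1)] Ck_on_SucD[OF Suc.prems(2)])
      (use Suc.prems in auto)
  with has_derivative_mult[OF Ck_on_Suc_has_derivative[OF Suc.prems(1)]
      Ck_on_Suc_has_derivative[OF Suc.prems(2)]]
  show ?case by (rule Ck_on_SucI[OF assms(1)])
qed

lemma Ck_on_sum:
  assumes "open S" "\<And>i. i \<in> I \<Longrightarrow> Ck_on k (f i) S"
  shows "Ck_on k (\<lambda>x. \<Sum>i\<in>I. f i x) S"
  using assms(2)
  by (induction I rule: infinite_finite_induct) (auto intro!: Ck_on_const Ck_on_add assms(1))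

lemma Ck_on_inverse:
  fixes f :: "'a::real_normed_vector \<Rightarrow> real"
  assumes "open S" "\<And>x. x \<in> S \<Longrightarrow> f x \<noteq> 0" "Ck_on k f S"
  shows "Ck_on k (\<lambda>x. inverse (f x)) S"
  using assms(3)
proof (induction k)
  case 0
  then show ?case using assms(2) by (auto intro: continuous_intros)
next
  case (Suc k)
  have *: "Ck_on k (\<lambda>x. - 1 * (inverse (f x) * frechet_derivative f (at x) v * inverse (f x))) S" for v
    by (intro Ck_on_mult Ck_on_const assms(1) Suc.IH Ck_on_SucD[OF Suc.prems]) (use Suc.prems in auto)
  have "((\<lambda>x. inverse (f x)) has_derivative
      (\<lambda>v. - 1 * (inverse (f x) * frechet_derivative f (at x) v * inverse (f x)))) (at x)" if "x \<in> S" for x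
    using Deriv.has_derivative_inverse[OF assms(2)[OF that] Ck_on_Suc_has_derivative[OF Suc.prems that]]
    by simp
  then show ?case using * by (intro Ck_on_SucI[OF assms(1)])
qed

text \<open>Expanding the derivative of \<open>g\<close> in the standard basis turns the chain rule into a sum of products
  of real functions, to which the induction hypothesis applies with each \<open>\<partial>\<^sub>b g\<close> in place of \<open>g\<close>.\<close>

lemma Ck_on_compose:
  fixes f :: "'a::real_normed_vector \<Rightarrow> 'b::euclidean_space" and g :: "'b \<Rightarrow> real"
  assumes "open S" "f ` S \<subseteq> T" "Ck_on k f S" "Ck_on k g T"
  shows "Ck_on k (\<lambda>x. g (f x)) S"
  using assms(3,4)
proof (induction k arbitrary: g)
  case 0
  then show ?case using assms(2) by (auto intro: continuous_on_compose2)
next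
  case (Suc k)
  let ?f' = "\<lambda>x. frechet_derivative f (at x)" and ?g' = "\<lambda>x. frechet_derivative g (at x)"
  have "Ck_on k (\<lambda>x. \<Sum>b\<in>Basis. (?f' x v \<bullet> b) * ?g' (f x) b) S" for v
    by (intro Ck_on_sum Ck_on_mult assms(1) Ck_on_bounded_linear[of _ "\<lambda>z. z \<bullet> _"] Suc.IH
        Ck_on_SucD[OF Suc.prems(1)] bounded_linear_inner_left) (use Suc.prems in auto)
  moreover have "((\<lambda>x. g (f x)) has_derivative (\<lambda>v. \<Sum>b\<in>Basis. (?f' x v \<bullet> b) * ?g' (f x) b)) (at x)"
    if x: "x \<in> S" for x
  proof -
    have gd: "(g has_derivative ?g' (f x)) (at (f x))"
      using x assms(2) by (intro Ck_on_Suc_has_derivative[OF Suc.prems(2)]) auto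
    then interpret g': linear "?g' (f x)" by (rule has_derivative_linear)
    have "?g' (f x) (?f' x v) = (\<Sum>b\<in>Basis. (?f' x v \<bullet> b) * ?g' (f x) b)" for v
      using g'.sum[of "\<lambda>b. (?f' x v \<bullet> b) *\<^sub>R b" Basis]
      by (simp add: euclidean_representation g'.scale)
    then show ?thesis
      using has_derivative_compose[OF Ck_on_Suc_has_derivative[OF Suc.prems(1) x] gd] by simp
  qed
  ultimately show ?case by (intro Ck_on_SucI[OF assms(1)])
qed

lemma Ck_on_local:
  assumes "\<And>x. x \<in> S \<Longrightarrow> \<exists>T. open T \<and> x \<in> T \<and> Ck_on k f T"
  shows "Ck_on k f S"
  using assms
proof (induction k arbitrary: f)
  case 0
  have "isCont f x" if "x \<in> S" for x
    using "0.prems"[OF that] by (auto simp: continuous_on_eq_continuous_at)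
  then show ?case by (auto intro: continuous_at_imp_continuous_on)
next
  case (Suc k)
  have "Ck_on k (\<lambda>x. frechet_derivative f (at x) v) S" for v
    by (rule Suc.IH) (use Suc.prems in fastforce)
  then show ?case using Suc.prems by fastforce
qed

section \<open>Bump functions and Hadamard's lemma\<close>

lemma smooth_on_frechet_derivative:
  "smooth_on f S \<Longrightarrow> smooth_on (\<lambda>x. frechet_derivative f (at x) v) S"
  unfolding smooth_on_def by (metis Ck_on.simps(2))

lemma smooth_on_has_derivative:
  "smooth_on f S \<Longrightarrow> x \<in> S \<Longrightarrow> (f has_derivative frechet_derivative f (at x)) (at x)"
  unfolding smooth_on_def using Ck_on_Suc_has_derivative by blast

text \<open>For \<open>n = 0\<close> this is the classical function that is flat at \<open>0\<close>. The other exponents are included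
  because the derivative of a member is a linear combination of members (\<open>flat_exp_DERIV\<close>), so that
  smoothness of all of them follows by one induction.\<close>

definition flat_exp :: "nat \<Rightarrow> real \<Rightarrow> real" where
  "flat_exp n t = (if t > 0 then exp (- 1 / t) / t ^ n else 0)"

lemma flat_exp_tendsto_0: "(flat_exp n \<longlongrightarrow> 0) (at 0)"
proof -
  have "((\<lambda>t. inverse t ^ n / exp (inverse t)) \<longlongrightarrow> (0::real)) (at_right 0)"
    by (rule filterlim_compose[OF tendsto_power_div_exp_0 filterlim_inverse_at_top_right])
  moreover have "\<forall>\<^sub>F t in at_right 0. inverse t ^ n / exp (inverse t) = flat_exp n t"
    by (rule eventually_mono[OF eventually_at_right_less[of 0]])
      (simp add: flat_exp_def inverse_eq_divide exp_minus field_simps)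
  ultimately have "(flat_exp n \<longlongrightarrow> 0) (at_right 0)"
    by (rule Lim_transform_eventually)
  moreover have "(flat_exp n \<longlongrightarrow> 0) (at_left 0)"
    by (rule tendsto_eventually, rule eventually_at_leftI[of "- 1"]) (auto simp: flat_exp_def)
  ultimately show ?thesis by (simp add: filterlim_split_at)
qed

lemma flat_exp_DERIV:
  "(flat_exp n has_real_derivative (flat_exp (n + 2) t - n * flat_exp (n + 1) t)) (at t)"
proof -
  consider "t > 0" | "t < 0" | "t = 0" by linarith
  then show ?thesis
  proof cases
    case 1
    have "((\<lambda>t. exp (- 1 / t) / t ^ n) has_real_derivative (flat_exp (n + 2) t - n * flat_exp (n + 1) t)) (at t)"
      using 1
      by (cases n; auto intro!: derivative_eq_intros simp: flat_exp_def field_simps power2_eq_square;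
          metis One_nat_def power_eq_if)
    then show ?thesis
      by (rule has_field_derivative_transform_within_open[where S = "{0<..}"])
        (use 1 in \<open>auto simp: flat_exp_def\<close>)
  next
    case 2
    have "((\<lambda>t. 0) has_real_derivative (flat_exp (n + 2) t - n * flat_exp (n + 1) t)) (at t)"
      using 2 by (auto simp: flat_exp_def)
    then show ?thesis
      by (rule has_field_derivative_transform_within_open[where S = "{..<0}"])
        (use 2 in \<open>auto simp: flat_exp_def\<close>)
  next
    case 3
    have "flat_exp m 0 = 0" "flat_exp n y / y = flat_exp (Suc n) y" for m y
      by (auto simp: flat_exp_def)
    then show ?thesis
      using 3 flat_exp_tendsto_0[of "Suc n"] by (simp add: has_field_derivative_iff)
  qed
qed

lemma Ck_on_flat_exp: "Ck_on k (flat_exp n) UNIV"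
proof (induction k arbitrary: n)
  case 0
  then show ?case
    using DERIV_isCont[OF flat_exp_DERIV] by (auto simp: continuous_on_eq_continuous_at)
next
  case (Suc k)
  have "Ck_on k (\<lambda>x. (flat_exp (n + 2) x + - real n * flat_exp (n + 1) x) * v) UNIV" for v
    by (intro Ck_on_add Ck_on_mult Suc.IH Ck_on_const) auto
  then show ?case
    by (intro Ck_on_SucI[of _ _ "\<lambda>x v. (flat_exp (n + 2) x + - real n * flat_exp (n + 1) x) * v"])
      (use flat_exp_DERIV[of n] in \<open>auto simp: has_field_derivative_def\<close>)
qed

lemma smooth_bump:
  fixes a :: "'e::euclidean_space"
  assumes "d > 0"
  shows "\<exists>\<beta> :: 'e \<Rightarrow> real. smooth_on \<beta> UNIV \<and> \<beta> a = 1 \<and> (\<forall>x. x \<notin> cball a d \<longrightarrow> \<beta> x = 0)"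
proof -
  \<comment> \<open>\<open>\<rho>\<close> is the polynomial \<open>d\<^sup>2 - |x - a|\<^sup>2\<close>, positive exactly inside the ball; the factor in \<open>\<beta>\<close>
     normalises the value at the centre.\<close>
  define \<rho> where "\<rho> x = d\<^sup>2 + - 1 * (\<Sum>b\<in>Basis. ((x + - a) \<bullet> b) * ((x + - a) \<bullet> b))" for x
  define \<beta> where "\<beta> x = exp (1 / d\<^sup>2) * flat_exp 0 (\<rho> x)" for x
  have \<rho>: "\<rho> x = d\<^sup>2 - (dist a x)\<^sup>2" for x
    by (simp add: \<rho>_def dist_norm norm_minus_commute[of a] power2_norm_eq_inner
        euclidean_inner[of "x - a" "x - a"])
  have "Ck_on k \<rho> UNIV" for k
    unfolding \<rho>_def
    by (intro Ck_on_sum Ck_on_mult Ck_on_add Ck_on_const Ck_on_id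
        Ck_on_bounded_linear[of _ "\<lambda>z. z \<bullet> _"] bounded_linear_inner_left) auto
  then have "Ck_on k \<beta> UNIV" for k
    unfolding \<beta>_def
    by (intro Ck_on_mult[OF open_UNIV Ck_on_const] Ck_on_compose[OF open_UNIV subset_UNIV _ Ck_on_flat_exp])
  moreover have "\<beta> a = 1"
    using assms exp_minus_inverse[of "1 / d\<^sup>2"] by (simp add: \<beta>_def \<rho> flat_exp_def)
  moreover have "\<beta> x = 0" if "x \<notin> cball a d" for x
  proof -
    have "d\<^sup>2 < (dist a x)\<^sup>2" using that assms by (intro power_strict_mono) auto
    then show ?thesis by (simp add: \<beta>_def \<rho> flat_exp_def)
  qed
  ultimately show ?thesis by (intro exI[of _ \<beta>]) (auto simp: smooth_on_def)
qed

text \<open>Differentiating under the integral sign produces an integral of the same shape with \<open>F\<close> replaced by a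
  directional derivative and one more factor \<open>t\<close> from the inner derivative. The weight \<open>t ^ j\<close> makes room
  for that factor.\<close>

lemma Ck_on_segment_integral:
  fixes F :: "'e::euclidean_space \<Rightarrow> real"
  assumes S: "open S" "convex S" "a \<in> S" and "Ck_on k F S"
  shows "Ck_on k (\<lambda>x. integral (cbox 0 1) (\<lambda>t. t ^ j * F (a + t *\<^sub>R (x - a)))) S"
proof -
  have seg: "a + t *\<^sub>R (x - a) \<in> S" if "x \<in> S" "t \<in> cbox 0 1" for x t
    using convexD_alt[OF S(2) S(3) that(1), of t] that(2) by (simp add: algebra_simps)
  have line: "continuous_on (S \<times> cbox 0 1) (\<lambda>p. H (a + snd p *\<^sub>R (fst p - a)))"
    if "continuous_on S H" for H :: "'e \<Rightarrow> real"
    by (rule continuous_on_compose2[OF that]) (auto intro!: continuous_intros seg)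
  show ?thesis
    using assms(4)
  proof (induction k arbitrary: F j)
    case (0 F j)
    have "continuous_on (S \<times> cbox 0 1) (\<lambda>(x, t). t ^ j * F (a + t *\<^sub>R (x - a)))"
      unfolding split_beta by (intro continuous_on_mult continuous_intros line[of F]) (use 0 in simp)
    then show ?case
      by (simp only: Ck_on.simps integral_continuous_on_param)
  next
    case (Suc k F j)
    let ?F' = "\<lambda>x. frechet_derivative F (at x)"
    define fx where "fx x t = t ^ Suc j *\<^sub>R Blinfun (?F' (a + t *\<^sub>R (x - a)))" for x t
    have F': "(F has_derivative ?F' x) (at x)" if "x \<in> S" for x
      by (rule Ck_on_Suc_has_derivative[OF Suc.prems that])
    have fx: "blinfun_apply (fx x t) v = t ^ Suc j * ?F' (a + t *\<^sub>R (x - a)) v"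
      if "x \<in> S" "t \<in> cbox 0 1" for x t v
      using has_derivative_bounded_linear[OF F'[OF seg[OF that]]]
      by (simp add: fx_def scaleR_blinfun.rep_eq bounded_linear_Blinfun_apply)
    have contF': "continuous_on S (\<lambda>x. ?F' x v)" for v
      by (rule Ck_on_imp_continuous_on[of k]) (use Suc.prems in simp)
    have contF: "continuous_on S F"
      by (rule Ck_on_imp_continuous_on[OF Suc.prems])
    have cont_fx: "continuous_on (S \<times> cbox 0 1) (\<lambda>(x, t). fx x t)"
    proof (rule continuous_on_blinfun_componentwise)
      fix v :: 'e
      have "continuous_on (S \<times> cbox 0 1) (\<lambda>p. snd p ^ Suc j * ?F' (a + snd p *\<^sub>R (fst p - a)) v)"
        by (intro continuous_on_mult continuous_intros line contF')
      then show "continuous_on (S \<times> cbox 0 1) (\<lambda>p. blinfun_apply (case p of (x, t) \<Rightarrow> fx x t) v)"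
        by (rule continuous_on_eq) (use fx in auto)
    qed
    have "((\<lambda>x. integral (cbox 0 1) (\<lambda>t. t ^ j * F (a + t *\<^sub>R (x - a))))
        has_derivative (\<lambda>v. integral (cbox 0 1) (\<lambda>t. t ^ Suc j * ?F' (a + t *\<^sub>R (x - a)) v))) (at x)"
      if x: "x \<in> S" for x
    proof -
      have "((\<lambda>x. integral (cbox 0 1) (\<lambda>t. t ^ j * F (a + t *\<^sub>R (x - a)))) has_derivative
          integral (cbox 0 1) (fx x)) (at x within S)"
      proof (rule leibniz_rule[OF _ _ cont_fx x S(2)])
        fix y t :: _ assume yt: "y \<in> S" "t \<in> cbox (0::real) 1"
        have "((\<lambda>y. a + t *\<^sub>R (y - a)) has_derivative (\<lambda>v. t *\<^sub>R v)) (at y within S)"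
          by (auto intro!: derivative_eq_intros)
        from has_derivative_mult_right[OF has_derivative_compose[OF this F'[OF seg[OF yt]]], of "t ^ j"]
        show "((\<lambda>y. t ^ j * F (a + t *\<^sub>R (y - a))) has_derivative blinfun_apply (fx y t)) (at y within S)"
          by (rule has_derivative_eq_rhs)
            (use fx[OF yt] linear_cmul[OF has_derivative_linear[OF F'[OF seg[OF yt]]]] in \<open>auto simp: fun_eq_iff\<close>)
      next
        fix y assume y: "y \<in> S"
        show "(\<lambda>t. t ^ j * F (a + t *\<^sub>R (y - a))) integrable_on cbox 0 1"
          using y by (intro integrable_continuous continuous_on_mult continuous_intros
              continuous_on_compose2[OF line[OF contF], of _ "\<lambda>t. (y, t)", simplified]) auto
      qed
      then have "((\<lambda>x. integral (cbox 0 1) (\<lambda>t. t ^ j * F (a + t *\<^sub>R (x - a)))) has_derivative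
          integral (cbox 0 1) (fx x)) (at x)"
        using at_within_open[OF x S(1)] by metis
      moreover have "blinfun_apply (integral (cbox 0 1) (fx x)) =
          (\<lambda>v. integral (cbox 0 1) (\<lambda>t. t ^ Suc j * ?F' (a + t *\<^sub>R (x - a)) v))"
      proof
        fix v
        have "fx x integrable_on cbox 0 1"
          by (intro integrable_continuous continuous_on_compose2[OF cont_fx, of _ "\<lambda>t. (x, t)", simplified]
              continuous_intros) (use x in auto)
        then show "blinfun_apply (integral (cbox 0 1) (fx x)) v =
            integral (cbox 0 1) (\<lambda>t. t ^ Suc j * ?F' (a + t *\<^sub>R (x - a)) v)"
          by (subst blinfun_apply_integral) (auto intro!: integral_cong simp: fx x simp del: power_Suc)
      qed
      ultimately show ?thesis by (simp only:)
    qed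
    moreover have "Ck_on k (\<lambda>x. integral (cbox 0 1) (\<lambda>t. t ^ Suc j * ?F' (a + t *\<^sub>R (x - a)) v)) S" for v
      by (rule Suc.IH) (use Suc.prems in auto)
    ultimately show ?case by (rule Ck_on_SucI[OF S(1)])
  qed
qed

text \<open>Integrate the derivative of \<open>f\<close> along the segment from \<open>a\<close> to \<open>x\<close>; the coefficient of \<open>(x - a) \<bullet> b\<close> is the
  average of \<open>\<partial>\<^sub>b f\<close> over the segment.\<close>

lemma hadamard:
  fixes f :: "'e::euclidean_space \<Rightarrow> real"
  assumes S: "open S" "convex S" "a \<in> S" and f: "smooth_on f S"
  obtains h where "\<And>b. smooth_on (h b) S" "\<And>b. h b a = frechet_derivative f (at a) b"
    "\<And>x. x \<in> S \<Longrightarrow> f x = f a + (\<Sum>b\<in>Basis. ((x - a) \<bullet> b) * h b x)"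
proof
  let ?f' = "\<lambda>x. frechet_derivative f (at x)"
  define h where "h b x = integral (cbox 0 1) (\<lambda>t. t ^ 0 * ?f' (a + t *\<^sub>R (x - a)) b)" for b x
  show "smooth_on (h b) S" for b
    using Ck_on_segment_integral[OF S, where j = 0] smooth_on_frechet_derivative[OF f]
    unfolding smooth_on_def h_def by blast
  show "h b a = ?f' a b" for b
    by (simp add: h_def)
  show "f x = f a + (\<Sum>b\<in>Basis. ((x - a) \<bullet> b) * h b x)" if x: "x \<in> S" for x
  proof -
    have seg: "a + t *\<^sub>R (x - a) \<in> S" if "t \<in> {0..1}" for t
      using convexD_alt[OF S(2) S(3) x, of t] that by (simp add: algebra_simps)
    have f': "linear (?f' (a + t *\<^sub>R (x - a)))" if "t \<in> {0..1}" for t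
      using smooth_on_has_derivative[OF f seg[OF that]] by (rule has_derivative_linear)
    have "((\<lambda>t. f (a + t *\<^sub>R (x - a))) has_vector_derivative ?f' (a + t *\<^sub>R (x - a)) (x - a))
        (at t within {0..1})" if t: "t \<in> {0..1}" for t
    proof -
      have "((\<lambda>t. a + t *\<^sub>R (x - a)) has_derivative (\<lambda>s. s *\<^sub>R (x - a))) (at t within {0..1})"
        by (auto intro!: derivative_eq_intros)
      from has_derivative_compose[OF this smooth_on_has_derivative[OF f seg[OF t]]]
      show ?thesis
        by (simp add: has_vector_derivative_def linear_cmul[OF f'[OF t]])
    qed
    then have "((\<lambda>t. ?f' (a + t *\<^sub>R (x - a)) (x - a)) has_integral (f x - f a)) {0..1}"
      using fundamental_theorem_of_calculus[of 0 1 "\<lambda>t. f (a + t *\<^sub>R (x - a))"] by simp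
    moreover have "?f' (a + t *\<^sub>R (x - a)) (x - a) =
        (\<Sum>b\<in>Basis. ((x - a) \<bullet> b) * ?f' (a + t *\<^sub>R (x - a)) b)" if "t \<in> {0..1}" for t
    proof -
      interpret linear "?f' (a + t *\<^sub>R (x - a))" by (rule f'[OF that])
      show ?thesis
        using sum[of "\<lambda>b. ((x - a) \<bullet> b) *\<^sub>R b" Basis] by (simp add: euclidean_representation scale)
    qed
    ultimately have "((\<lambda>t. \<Sum>b\<in>Basis. ((x - a) \<bullet> b) * ?f' (a + t *\<^sub>R (x - a)) b)
        has_integral (f x - f a)) {0..1}"
      by (rule has_integral_eq[rotated])
    moreover have "((\<lambda>t. \<Sum>b\<in>Basis. ((x - a) \<bullet> b) * ?f' (a + t *\<^sub>R (x - a)) b)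
        has_integral (\<Sum>b\<in>Basis. ((x - a) \<bullet> b) * h b x)) {0..1}"
    proof (intro has_integral_sum has_integral_mult_right finite_Basis)
      fix b :: 'e
      have "continuous_on S (\<lambda>x. ?f' x b)"
        using smooth_on_frechet_derivative[OF f, of b] unfolding smooth_on_def by (metis Ck_on.simps(1))
      then have "(\<lambda>t. ?f' (a + t *\<^sub>R (x - a)) b) integrable_on {0..1}"
        by (intro integrable_continuous_real, rule continuous_on_compose2[of S "\<lambda>x. ?f' x b"])
          (auto intro!: continuous_intros seg)
      then show "((\<lambda>t. ?f' (a + t *\<^sub>R (x - a)) b) has_integral h b x) {0..1}"
        by (simp add: h_def integrable_integral)
    qed
    ultimately have "f x - f a = (\<Sum>b\<in>Basis. ((x - a) \<bullet> b) * h b x)"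
      by (rule has_integral_unique)
    then show ?thesis by simp
  qed
qed

lemma smooth_on_subset: "smooth_on f S \<Longrightarrow> T \<subseteq> S \<Longrightarrow> smooth_on f T"
  unfolding smooth_on_def using Ck_on_subset by blast

lemma smooth_on_cong:
  "open S \<Longrightarrow> (\<And>x. x \<in> S \<Longrightarrow> f x = g x) \<Longrightarrow> smooth_on f S \<Longrightarrow> smooth_on g S"
  unfolding smooth_on_def using Ck_on_cong by blast

section \<open>Smooth functions on a manifold\<close>

lemma scaleR_fun_apply: "(c *\<^sub>R f) x = c *\<^sub>R f x"
  by (simp add: scaleR_fun_def)

lemma sum_fun_apply: "(\<Sum>i\<in>I. f i) x = (\<Sum>i\<in>I. f i x)"
  by (induction I rule: infinite_finite_induct) auto

locale smooth_manifold =
  fixes A :: "('m::{t2_space, second_countable_topology}, 'e::euclidean_space) atlas"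
  assumes atlas: "smooth_atlas A"
begin

lemma chart_cover: obtains U \<phi> where "(U, \<phi>) \<in> A" "p \<in> U"
  using atlas unfolding smooth_atlas_def by blast

lemma
  assumes "(U, \<phi>) \<in> A"
  shows chart_open: "open U"
    and chart_homeomorphism: "homeomorphism U (\<phi> ` U) \<phi> (inv_into U \<phi>)"
    and chart_inv: "x \<in> U \<Longrightarrow> inv_into U \<phi> (\<phi> x) = x"
    and chart_open_image: "open V \<Longrightarrow> V \<subseteq> U \<Longrightarrow> open (\<phi> ` V)"
proof -
  show *: "open U" "homeomorphism U (\<phi> ` U) \<phi> (inv_into U \<phi>)"
    using atlas assms unfolding smooth_atlas_def chart_def by auto
  then show "x \<in> U \<Longrightarrow> inv_into U \<phi> (\<phi> x) = x"
    by (simp add: homeomorphism_def)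
  assume "open V" "V \<subseteq> U"
  then have "openin (top_of_set (\<phi> ` U)) (\<phi> ` V)"
    using homeomorphism_imp_open_map[OF *(2)] *(1) by (simp add: open_subset)
  moreover have "open (\<phi> ` U)"
    using atlas assms unfolding smooth_atlas_def chart_def by auto
  ultimately show "open (\<phi> ` V)"
    by (rule openin_open_trans)
qed

lemma chart_transition:
  "(U, \<phi>) \<in> A \<Longrightarrow> (V, \<psi>) \<in> A \<Longrightarrow> smooth_on (\<psi> \<circ> inv_into U \<phi>) (\<phi> ` (U \<inter> V))"
  using atlas unfolding smooth_atlas_def by blast

lemma smooth_fun_onD:
  "smooth_fun_on A W f \<Longrightarrow> (U, \<phi>) \<in> A \<Longrightarrow> smooth_on (f \<circ> inv_into U \<phi>) (\<phi> ` (U \<inter> W))"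
  unfolding smooth_fun_on_def by blast

lemma smooth_fun_on_subset: "smooth_fun_on A W f \<Longrightarrow> V \<subseteq> W \<Longrightarrow> smooth_fun_on A V f"
  unfolding smooth_fun_on_def by (blast intro: smooth_on_subset)

lemma open_chart_part: "(U, \<phi>) \<in> A \<Longrightarrow> open W \<Longrightarrow> open (\<phi> ` (U \<inter> W))"
  using chart_open chart_open_image by (simp add: open_Int)

lemma smooth_fun_on_cong:
  assumes "open W" "\<And>x. x \<in> W \<Longrightarrow> f x = h x" "smooth_fun_on A W f"
  shows "smooth_fun_on A W h"
proof -
  have "smooth_on (h \<circ> inv_into U \<phi>) (\<phi> ` (U \<inter> W))" if c: "(U, \<phi>) \<in> A" for U \<phi>
    by (rule smooth_on_cong[OF open_chart_part[OF c assms(1)] _ smooth_fun_onD[OF assms(3) c]])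
      (auto simp: chart_inv[OF c] assms(2))
  then show ?thesis unfolding smooth_fun_on_def by blast
qed

lemma smooth_fun_on_const: "smooth_fun_on A W (\<lambda>x. c)"
  by (auto simp: smooth_fun_on_def smooth_on_def comp_def Ck_on_const)

lemma smooth_fun_on_add:
  "open W \<Longrightarrow> smooth_fun_on A W f \<Longrightarrow> smooth_fun_on A W h \<Longrightarrow> smooth_fun_on A W (\<lambda>x. f x + h x)"
  by (auto simp: smooth_fun_on_def smooth_on_def comp_def intro!: Ck_on_add open_chart_part)

lemma smooth_fun_on_mult:
  "open W \<Longrightarrow> smooth_fun_on A W f \<Longrightarrow> smooth_fun_on A W h \<Longrightarrow> smooth_fun_on A W (\<lambda>x. f x * h x)"
  by (auto simp: smooth_fun_on_def smooth_on_def comp_def intro!: Ck_on_mult open_chart_part)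

lemma smooth_fun_on_diff:
  assumes "open W" "smooth_fun_on A W f" "smooth_fun_on A W h"
  shows "smooth_fun_on A W (\<lambda>x. f x - h x)"
  using smooth_fun_on_add[OF assms(1,2) smooth_fun_on_mult[OF assms(1) smooth_fun_on_const[of _ "- 1"] assms(3)]]
  by simp

lemma smooth_fun_on_sum:
  assumes "open W" "\<And>i. i \<in> I \<Longrightarrow> smooth_fun_on A W (f i)"
  shows "smooth_fun_on A W (\<lambda>x. \<Sum>i\<in>I. f i x)"
  using assms(2)
  by (induction I rule: infinite_finite_induct)
    (auto intro: smooth_fun_on_const smooth_fun_on_add[OF assms(1)])

lemma smooth_fun_on_divide:
  assumes "open W" "smooth_fun_on A W f" "smooth_fun_on A W h" "\<And>x. x \<in> W \<Longrightarrow> h x \<noteq> 0"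
  shows "smooth_fun_on A W (\<lambda>x. f x / h x)"
proof -
  have "smooth_on ((\<lambda>x. inverse (h x)) \<circ> inv_into U \<phi>) (\<phi> ` (U \<inter> W))" if c: "(U, \<phi>) \<in> A" for U \<phi>
    unfolding smooth_on_def comp_def
    by (intro allI Ck_on_inverse open_chart_part[OF c assms(1)])
      (use smooth_fun_onD[OF assms(3) c] assms(4) in \<open>auto simp: smooth_on_def comp_def chart_inv[OF c]\<close>)
  then have "smooth_fun_on A W (\<lambda>x. inverse (h x))"
    unfolding smooth_fun_on_def by blast
  from smooth_fun_on_mult[OF assms(1,2) this] show ?thesis
    by (simp add: divide_inverse)
qed

text \<open>Smoothness is a local property, which allows smooth functions to be glued.\<close>

lemma smooth_fun_on_local:
  assumes "\<And>x. x \<in> W \<Longrightarrow> \<exists>T. open T \<and> x \<in> T \<and> smooth_fun_on A T f"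
  shows "smooth_fun_on A W f"
proof -
  have "Ck_on k (f \<circ> inv_into U \<phi>) (\<phi> ` (U \<inter> W))" if c: "(U, \<phi>) \<in> A" for U \<phi> k
  proof (rule Ck_on_local)
    fix y assume "y \<in> \<phi> ` (U \<inter> W)"
    then obtain x where x: "x \<in> U" "x \<in> W" "y = \<phi> x" by auto
    obtain T where "open T" "x \<in> T" "smooth_fun_on A T f" using assms x(2) by blast
    then show "\<exists>T. open T \<and> y \<in> T \<and> Ck_on k (f \<circ> inv_into U \<phi>) T"
      using open_chart_part[OF c] smooth_fun_onD[OF _ c] x
      by (intro exI[of _ "\<phi> ` (U \<inter> T)"]) (auto simp: smooth_on_def)
  qed
  then show ?thesis unfolding smooth_fun_on_def smooth_on_def by blast
qed

text \<open>A single chart containing \<open>W\<close> suffices, since any other local representative differs by a smooth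
  transition map.\<close>

lemma smooth_fun_on_chart:
  assumes c: "(U, \<phi>) \<in> A" and W: "open W" "W \<subseteq> U" and f: "smooth_on (f \<circ> inv_into U \<phi>) (\<phi> ` W)"
  shows "smooth_fun_on A W f"
proof -
  have "Ck_on k (f \<circ> inv_into V \<psi>) (\<psi> ` (V \<inter> W))" if d: "(V, \<psi>) \<in> A" for V \<psi> k
  proof (rule Ck_on_cong)
    show o: "open (\<psi> ` (V \<inter> W))" by (rule open_chart_part[OF d W(1)])
    show "Ck_on k (\<lambda>y. (f \<circ> inv_into U \<phi>) ((\<phi> \<circ> inv_into V \<psi>) y)) (\<psi> ` (V \<inter> W))"
    proof (rule Ck_on_compose[OF o, of "\<phi> \<circ> inv_into V \<psi>" "\<phi> ` W"])
      show "(\<phi> \<circ> inv_into V \<psi>) ` \<psi> ` (V \<inter> W) \<subseteq> \<phi> ` W"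
        by (auto simp: chart_inv[OF d])
      show "Ck_on k (\<phi> \<circ> inv_into V \<psi>) (\<psi> ` (V \<inter> W))"
        using chart_transition[OF d c] W(2) by (auto simp: smooth_on_def intro: Ck_on_subset)
      show "Ck_on k (f \<circ> inv_into U \<phi>) (\<phi> ` W)" using f by (simp add: smooth_on_def)
    qed
    show "(f \<circ> inv_into U \<phi>) ((\<phi> \<circ> inv_into V \<psi>) y) = (f \<circ> inv_into V \<psi>) y"
      if "y \<in> \<psi> ` (V \<inter> W)" for y
      using that W(2) by (auto simp: chart_inv[OF d] chart_inv[OF c])
  qed
  then show ?thesis unfolding smooth_fun_on_def smooth_on_def by blast
qed

lemma C_inf_iff: "f \<in> C_inf A \<longleftrightarrow> smooth_fun_on A UNIV f"
  by (simp add: C_inf_def)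

lemma C_inf_smooth_fun_on: "f \<in> C_inf A \<Longrightarrow> smooth_fun_on A W f"
  unfolding C_inf_iff by (rule smooth_fun_on_subset) auto

lemma C_inf_const [simp]: "(\<lambda>x. c) \<in> C_inf A"
  and C_inf_0 [simp]: "0 \<in> C_inf A"
  and C_inf_add: "f \<in> C_inf A \<Longrightarrow> h \<in> C_inf A \<Longrightarrow> f + h \<in> C_inf A"
  and C_inf_mult: "f \<in> C_inf A \<Longrightarrow> h \<in> C_inf A \<Longrightarrow> f * h \<in> C_inf A"
  and C_inf_diff: "f \<in> C_inf A \<Longrightarrow> h \<in> C_inf A \<Longrightarrow> f - h \<in> C_inf A"
  and C_inf_scaleR: "f \<in> C_inf A \<Longrightarrow> c *\<^sub>R f \<in> C_inf A"
  using smooth_fun_on_add[OF open_UNIV, of f h] smooth_fun_on_mult[OF open_UNIV, of f h]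
    smooth_fun_on_diff[OF open_UNIV, of f h]
    smooth_fun_on_mult[OF open_UNIV smooth_fun_on_const, of f c]
  by (simp_all add: C_inf_iff smooth_fun_on_const zero_fun_def plus_fun_def times_fun_def
      fun_diff_def scaleR_fun_def)

lemma C_inf_sum: "(\<And>i. i \<in> I \<Longrightarrow> f i \<in> C_inf A) \<Longrightarrow> sum f I \<in> C_inf A"
  by (induction I rule: infinite_finite_induct) (auto intro: C_inf_add)

text \<open>A bump function transported by a chart. In the Hausdorff space the image \<open>C\<close> of a closed ball is compact,
  hence closed, so that a function smooth on \<open>V\<close> times the cutoff can be glued along \<open>- C\<close> with the zero
  function. This is how local objects become global ones throughout.\<close>

lemma cutoff:
  assumes "open V" "p \<in> V"
  obtains \<kappa> where "\<kappa> \<in> C_inf A" "\<kappa> p = 1" "\<And>q. q \<notin> V \<Longrightarrow> \<kappa> q = 0"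
    "\<And>f. smooth_fun_on A V f \<Longrightarrow> \<kappa> * f \<in> C_inf A"
proof -
  obtain U \<phi> where c: "(U, \<phi>) \<in> A" and p: "p \<in> U" by (rule chart_cover)
  let ?inv = "inv_into U \<phi>"
  let ?W = "U \<inter> V"
  have oW: "open ?W" using chart_open[OF c] assms(1) by auto
  have "open (\<phi> ` ?W)" by (rule open_chart_part[OF c assms(1)])
  then obtain d where d: "d > 0" "cball (\<phi> p) d \<subseteq> \<phi> ` ?W"
    using p assms(2) unfolding open_contains_cball by (metis IntI imageI)
  obtain \<beta> :: "'e \<Rightarrow> real" where \<beta>: "smooth_on \<beta> UNIV" "\<beta> (\<phi> p) = 1" "\<And>x. x \<notin> cball (\<phi> p) d \<Longrightarrow> \<beta> x = 0"
    using smooth_bump[OF d(1)] by blast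
  define \<kappa> where "\<kappa> q = (if q \<in> U then \<beta> (\<phi> q) else 0)" for q
  define C where "C = ?inv ` cball (\<phi> p) d"
  have "continuous_on (cball (\<phi> p) d) ?inv"
    using chart_homeomorphism[OF c] d(2)
    by (meson continuous_on_subset homeomorphism_cont2 image_mono inf_le1 order_trans)
  then have "compact C" unfolding C_def by (rule compact_continuous_image) simp
  then have oC: "open (- C)" by (simp add: compact_imp_closed open_Compl)
  have CW: "C \<subseteq> ?W"
    using d(2) chart_inv[OF c] unfolding C_def by fastforce
  have \<kappa>C: "\<kappa> q = 0" if "q \<notin> C" for q
    using that \<beta>(3)[of "\<phi> q"] chart_inv[OF c, of q] unfolding \<kappa>_def C_def by (metis image_eqI)
  have \<kappa>W: "smooth_fun_on A ?W \<kappa>"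
  proof (rule smooth_fun_on_chart[OF c oW])
    show "smooth_on (\<kappa> \<circ> ?inv) (\<phi> ` ?W)"
      by (rule smooth_on_cong[OF open_chart_part[OF c assms(1)] _ smooth_on_subset[OF \<beta>(1) subset_UNIV]])
        (auto simp: \<kappa>_def chart_inv[OF c])
  qed simp
  have *: "\<kappa> * f \<in> C_inf A" if f: "smooth_fun_on A V f" for f
    unfolding C_inf_iff
  proof (rule smooth_fun_on_local)
    fix x
    have "smooth_fun_on A ?W (\<lambda>x. \<kappa> x * f x)"
      by (intro smooth_fun_on_mult oW \<kappa>W smooth_fun_on_subset[OF f]) simp
    moreover have "smooth_fun_on A (- C) (\<lambda>x. \<kappa> x * f x)"
      by (rule smooth_fun_on_cong[OF oC _ smooth_fun_on_const[of _ 0]]) (simp add: \<kappa>C)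
    ultimately show "\<exists>T. open T \<and> x \<in> T \<and> smooth_fun_on A T (\<kappa> * f)"
      unfolding times_fun_def using oW oC CW by (metis ComplI subsetD)
  qed
  show thesis
  proof (rule that[OF _ _ _ *])
    show "\<kappa> \<in> C_inf A" using *[OF smooth_fun_on_const[of _ 1]] by (simp add: times_fun_def)
    show "\<kappa> p = 1" using p \<beta>(2) by (simp add: \<kappa>_def)
    show "\<kappa> q = 0" if "q \<notin> V" for q using that CW \<kappa>C by auto
  qed
qed

section \<open>Tangent vectors in coordinates\<close>

abbreviation T :: "'m \<Rightarrow> 'm tvec set" where "T \<equiv> tangent_space A"

lemma subspace_tangent: "subspace (T p)"
  unfolding subspace_def tangent_space_def
  by (auto simp: scaleR_fun_def algebra_simps)

lemma
  assumes "v \<in> T p"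
  shows tangent_add: "f \<in> C_inf A \<Longrightarrow> h \<in> C_inf A \<Longrightarrow> v (f + h) = v f + v h"
    and tangent_scaleR: "f \<in> C_inf A \<Longrightarrow> v (c *\<^sub>R f) = c * v f"
    and tangent_mult: "f \<in> C_inf A \<Longrightarrow> h \<in> C_inf A \<Longrightarrow> v (f * h) = f p * v h + h p * v f"
    and tangent_nonsmooth: "f \<notin> C_inf A \<Longrightarrow> v f = 0"
  using assms unfolding tangent_space_def by auto

lemma tangent_0: "v \<in> T p \<Longrightarrow> v 0 = 0"
  using tangent_scaleR[of v p 0 0] by simp

lemma tangent_const: "v \<in> T p \<Longrightarrow> v (\<lambda>x. c) = 0"
proof -
  assume v: "v \<in> T p"
  have "v 1 = 0" using tangent_mult[OF v, of 1 1] by (simp add: one_fun_def times_fun_def)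
  then show "v (\<lambda>x. c) = 0"
    using tangent_scaleR[OF v, of 1 c] by (simp add: one_fun_def scaleR_fun_def)
qed

lemma tangent_diff:
  assumes "v \<in> T p" "f \<in> C_inf A" "h \<in> C_inf A"
  shows "v (f - h) = v f - v h"
  using tangent_add[OF assms(1,2) C_inf_scaleR[OF assms(3), of "- 1"]] tangent_scaleR[OF assms(1,3), of "- 1"]
  by simp

lemma tangent_sum:
  assumes "v \<in> T p" "\<And>i. i \<in> I \<Longrightarrow> f i \<in> C_inf A"
  shows "v (\<Sum>i\<in>I. f i) = (\<Sum>i\<in>I. v (f i))"
  using assms(2)
  by (induction I rule: infinite_finite_induct) (auto simp: tangent_0[OF assms(1)] tangent_add[OF assms(1)] C_inf_sum)

text \<open>The coordinate derivative \<open>\<partial>\<^sub>b\<close> of the chart, with the value \<open>0\<close> on non-smooth functions that tangent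
  vectors are required to have.\<close>

definition coord_vec :: "'m set \<Rightarrow> ('m \<Rightarrow> 'e) \<Rightarrow> 'e \<Rightarrow> 'm vfield" where
  "coord_vec U \<phi> b p f =
     (if f \<in> C_inf A then frechet_derivative (f \<circ> inv_into U \<phi>) (at (\<phi> p)) b else 0)"

lemma C_inf_chart_smooth: "f \<in> C_inf A \<Longrightarrow> (U, \<phi>) \<in> A \<Longrightarrow> smooth_on (f \<circ> inv_into U \<phi>) (\<phi> ` U)"
  using smooth_fun_onD[of UNIV f U \<phi>] by (simp add: C_inf_iff)

lemma C_inf_chart_derivative:
  "f \<in> C_inf A \<Longrightarrow> (U, \<phi>) \<in> A \<Longrightarrow> p \<in> U \<Longrightarrow>
    (f \<circ> inv_into U \<phi> has_derivative (\<lambda>b. coord_vec U \<phi> b p f)) (at (\<phi> p))"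
  using smooth_on_has_derivative[OF C_inf_chart_smooth, of f U \<phi> "\<phi> p"] by (simp add: coord_vec_def)

lemma coord_vec_eq:
  "f \<in> C_inf A \<Longrightarrow> (f \<circ> inv_into U \<phi> has_derivative D) (at (\<phi> p)) \<Longrightarrow> coord_vec U \<phi> b p f = D b"
  by (simp add: coord_vec_def frechet_derivative_at[symmetric])

lemma coord_vec_tangent:
  assumes c: "(U, \<phi>) \<in> A" and p: "p \<in> U"
  shows "coord_vec U \<phi> b p \<in> T p"
  unfolding tangent_space_def
proof (intro CollectI conjI ballI allI impI)
  fix f h assume f: "f \<in> C_inf A" and h: "h \<in> C_inf A"
  note df = C_inf_chart_derivative[OF f c p] and dh = C_inf_chart_derivative[OF h c p]
  show "coord_vec U \<phi> b p (f + h) = coord_vec U \<phi> b p f + coord_vec U \<phi> b p h"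
    using has_derivative_add[OF df dh]
    by (intro coord_vec_eq[OF C_inf_add[OF f h]]) (simp add: comp_def)
  show "coord_vec U \<phi> b p (f * h) = f p * coord_vec U \<phi> b p h + h p * coord_vec U \<phi> b p f"
    using has_derivative_mult[OF df dh]
    by (subst coord_vec_eq[OF C_inf_mult[OF f h]]) (auto simp: comp_def chart_inv[OF c p] mult.commute[of _ "h p"])
  show "coord_vec U \<phi> b p (k *\<^sub>R f) = k * coord_vec U \<phi> b p f" for k
    using has_derivative_mult_right[OF df, of k]
    by (intro coord_vec_eq[OF C_inf_scaleR[OF f]]) (simp add: comp_def scaleR_fun_def)
qed (simp add: coord_vec_def)

lemma coord_vec_local_section:
  assumes c: "(U, \<phi>) \<in> A"
  shows "coord_vec U \<phi> b \<in> local_sections A T U"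
  unfolding local_sections_def
proof (intro CollectI conjI ballI)
  show "coord_vec U \<phi> b p \<in> T p" if "p \<in> U" for p by (rule coord_vec_tangent[OF c that])
  fix f assume f: "f \<in> C_inf A"
  show "smooth_fun_on A U (\<lambda>p. coord_vec U \<phi> b p f)"
  proof (rule smooth_fun_on_chart[OF c chart_open[OF c] order_refl])
    show "smooth_on ((\<lambda>p. coord_vec U \<phi> b p f) \<circ> inv_into U \<phi>) (\<phi> ` U)"
      by (rule smooth_on_cong[OF _ _ smooth_on_frechet_derivative[OF C_inf_chart_smooth[OF f c], of b]])
        (use chart_open_image[OF c chart_open[OF c]] in \<open>auto simp: chart_inv[OF c] coord_vec_def f\<close>)
  qed
qed

text \<open>The functions \<open>\<xi> b\<close> are the centred coordinates times a cutoff, and form the dual basis of the coordinate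
  derivatives. A derivation at \<open>q\<close> is determined by its values on them: by Hadamard's lemma a smooth function
  is, near \<open>q\<close> and up to cutoff factors, a constant plus \<open>\<Sum>\<^sub>b \<xi> b * h b\<close>; since the \<open>\<xi> b\<close> vanish at \<open>q\<close>, the
  derivation sees of each \<open>h b\<close> only its value at \<open>q\<close>, which is the coordinate derivative.\<close>

lemma coordinate_expansion:
  assumes c: "(U, \<phi>) \<in> A" and q: "q \<in> U"
  obtains \<xi> :: "'e \<Rightarrow> 'm \<Rightarrow> real"
  where "\<And>b b'. b \<in> Basis \<Longrightarrow> b' \<in> Basis \<Longrightarrow> coord_vec U \<phi> b' q (\<xi> b) = (if b = b' then 1 else 0)"
    and "\<And>v. v \<in> T q \<Longrightarrow> v = (\<Sum>b\<in>Basis. v (\<xi> b) *\<^sub>R coord_vec U \<phi> b q)"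
proof -
  let ?inv = "inv_into U \<phi>"
  define a where "a = \<phi> q"
  have oU: "open U" "open (\<phi> ` U)"
    using chart_open[OF c] chart_open_image[OF c] by auto
  then obtain d where d: "d > 0" "ball a d \<subseteq> \<phi> ` U"
    using q unfolding a_def by (meson image_eqI open_contains_ball)
  define W where "W = U \<inter> \<phi> -` ball a d"
  have oW: "open W"
    unfolding W_def using continuous_open_preimage[OF homeomorphism_cont1[OF chart_homeomorphism[OF c]]] oU
    by blast
  have qW: "q \<in> W" "W \<subseteq> U" using q d by (auto simp: W_def a_def)
  have imW: "\<phi> ` W \<subseteq> ball a d" by (auto simp: W_def)
  have chart_W: "smooth_fun_on A W (\<lambda>x. h (\<phi> x))" if "smooth_on h (ball a d)" for h :: "'e \<Rightarrow> real"
    by (rule smooth_fun_on_chart[OF c oW qW(2)],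
        rule smooth_on_cong[OF chart_open_image[OF c oW qW(2)] _ smooth_on_subset[OF that imW]])
      (use qW(2) in \<open>auto simp: chart_inv[OF c]\<close>)
  obtain \<kappa> where \<kappa>: "\<kappa> \<in> C_inf A" "\<kappa> q = 1" "\<And>x. x \<notin> W \<Longrightarrow> \<kappa> x = 0"
    "\<And>f. smooth_fun_on A W f \<Longrightarrow> \<kappa> * f \<in> C_inf A"
    using cutoff[OF oW qW(1)] by metis
  define \<xi> where "\<xi> b = \<kappa> * (\<lambda>x. (\<phi> x - a) \<bullet> b)" for b
  have "smooth_on (\<lambda>y. (y + - a) \<bullet> b) (ball a d)" for b
    unfolding smooth_on_def
    by (intro allI Ck_on_bounded_linear[of _ "\<lambda>z. z \<bullet> b"] bounded_linear_inner_left
        Ck_on_add Ck_on_const Ck_on_id) auto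
  then have \<xi>: "\<xi> b \<in> C_inf A" for b
    unfolding \<xi>_def using chart_W \<kappa>(4) by force
  have \<xi>q: "\<xi> b q = 0" for b by (simp add: \<xi>_def a_def)
  show thesis
  proof (rule that)
    fix b b' :: 'e assume b: "b \<in> Basis" "b' \<in> Basis"
    have "((\<lambda>y. (\<kappa> \<circ> ?inv) y * ((y - a) \<bullet> b)) has_derivative
        (\<lambda>v. (\<kappa> \<circ> ?inv) a * (v \<bullet> b) + coord_vec U \<phi> v q \<kappa> * ((a - a) \<bullet> b))) (at a)"
      using C_inf_chart_derivative[OF \<kappa>(1) c q] unfolding a_def[symmetric]
      by (rule has_derivative_mult) (auto intro!: derivative_eq_intros)
    then have "(\<xi> b \<circ> ?inv has_derivative (\<lambda>v. v \<bullet> b)) (at a)"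
    proof (rule has_derivative_transform_within_open[OF has_derivative_eq_rhs oU(2)])
      show "a \<in> \<phi> ` U" using q by (simp add: a_def)
      show "(\<kappa> \<circ> ?inv) y * ((y - a) \<bullet> b) = (\<xi> b \<circ> ?inv) y" if "y \<in> \<phi> ` U" for y
        using that by (auto simp: \<xi>_def chart_inv[OF c])
    qed (simp add: chart_inv[OF c q] a_def \<kappa>(2))
    then have "coord_vec U \<phi> b' q (\<xi> b) = b' \<bullet> b"
      unfolding a_def by (rule coord_vec_eq[OF \<xi>])
    then show "coord_vec U \<phi> b' q (\<xi> b) = (if b = b' then 1 else 0)"
      using b by (auto simp: inner_Basis)
  next
    fix v assume v: "v \<in> T q"
    have "v f = (\<Sum>b\<in>Basis. coord_vec U \<phi> b q f * v (\<xi> b))" if f: "f \<in> C_inf A" for f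
    proof -
      obtain h where h: "\<And>b. smooth_on (h b) (ball a d)"
        "\<And>b. h b a = frechet_derivative (f \<circ> ?inv) (at a) b"
        "\<And>x. x \<in> ball a d \<Longrightarrow> (f \<circ> ?inv) x = (f \<circ> ?inv) a + (\<Sum>b\<in>Basis. ((x - a) \<bullet> b) * h b x)"
        using d(1) by (rule hadamard[OF open_ball convex_ball _ smooth_on_subset[OF C_inf_chart_smooth[OF f c] d(2)], of a, unfolded centre_in_ball]) (rule that)
      define H where "H b = \<kappa> * (\<lambda>x. h b (\<phi> x))" for b
      have H: "H b \<in> C_inf A" for b
        unfolding H_def by (intro \<kappa>(4) chart_W h(1))
      have Hq: "H b q = coord_vec U \<phi> b q f" for b
        using h(2)[of b] f by (simp add: H_def \<kappa>(2) coord_vec_def a_def)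
      let ?f0 = "f - (\<lambda>x. f q)"
      have f0: "?f0 \<in> C_inf A" by (intro C_inf_diff f C_inf_const)
      \<comment> \<open>Hadamard's lemma holds near \<open>q\<close> only. Of the two factors \<open>\<kappa>\<close>, one globalises \<open>\<xi> b\<close> and the
         other one \<open>H b\<close>. They do not change the derivative at \<open>q\<close>, where \<open>\<kappa> = 1\<close> and \<open>?f0 = 0\<close>.\<close>
      have eq: "(\<kappa> * \<kappa>) * ?f0 = (\<Sum>b\<in>Basis. \<xi> b * H b)"
      proof
        fix x
        show "((\<kappa> * \<kappa>) * ?f0) x = (\<Sum>b\<in>Basis. \<xi> b * H b) x"
        proof (cases "x \<in> W")
          case True
          then have "f x - f q = (\<Sum>b\<in>Basis. ((\<phi> x - a) \<bullet> b) * h b (\<phi> x))"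
            using h(3)[of "\<phi> x"] q by (simp add: W_def chart_inv[OF c] a_def)
          then show ?thesis
            by (simp add: sum_fun_apply \<xi>_def H_def sum_distrib_left algebra_simps)
        next
          case False
          then show ?thesis by (simp add: \<kappa>(3) sum_fun_apply \<xi>_def)
        qed
      qed
      have "v ((\<kappa> * \<kappa>) * ?f0) = v f"
        by (simp add: tangent_mult[OF v C_inf_mult[OF \<kappa>(1,1)] f0] \<kappa>(2)
            tangent_diff[OF v f C_inf_const] tangent_const[OF v])
      moreover have "v (\<Sum>b\<in>Basis. \<xi> b * H b) = (\<Sum>b\<in>Basis. coord_vec U \<phi> b q f * v (\<xi> b))"
        by (subst tangent_sum[OF v])
          (auto intro!: C_inf_mult \<xi> H simp: tangent_mult[OF v \<xi> H] \<xi>q Hq)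
      ultimately show ?thesis using eq by simp
    qed
    then have "v f = (\<Sum>b\<in>Basis. v (\<xi> b) *\<^sub>R coord_vec U \<phi> b q) f" for f
      by (cases "f \<in> C_inf A")
        (auto simp: sum_fun_apply scaleR_fun_def mult.commute tangent_nonsmooth[OF v] coord_vec_def)
    then show "v = (\<Sum>b\<in>Basis. v (\<xi> b) *\<^sub>R coord_vec U \<phi> b q)" by (rule ext)
  qed
qed

text \<open>With the tangent bundle as a distribution, orthogonal frames of \<open>TM\<close> and of \<open>E\<close> come from one lemma.\<close>

lemma tangent_distribution: "distribution A DIM('e) T"
  unfolding distribution_def
proof (intro conjI allI)
  show "subspace (T p)" "T p \<subseteq> T p" for p by (simp_all add: subspace_tangent)
  fix p
  obtain U \<phi> where c: "(U, \<phi>) \<in> A" and p: "p \<in> U" by (rule chart_cover)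
  obtain \<beta> :: "nat \<Rightarrow> 'e" where \<beta>: "bij_betw \<beta> {..<DIM('e)} Basis"
    using ex_bij_betw_nat_finite[OF finite_Basis] by (auto simp: atLeast0LessThan)
  have "inj_on (\<lambda>i. coord_vec U \<phi> (\<beta> i) q) {..<DIM('e)} \<and>
      independent ((\<lambda>i. coord_vec U \<phi> (\<beta> i) q) ` {..<DIM('e)}) \<and>
      span ((\<lambda>i. coord_vec U \<phi> (\<beta> i) q) ` {..<DIM('e)}) = T q" if q: "q \<in> U" for q
  proof -
    let ?e = "\<lambda>b. coord_vec U \<phi> b q"
    have im: "(\<lambda>i. ?e (\<beta> i)) ` {..<DIM('e)} = ?e ` Basis"
      using image_image[of ?e \<beta> "{..<DIM('e)}"] by (simp add: bij_betw_imp_surj_on[OF \<beta>])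
    obtain \<xi> where \<xi>: "\<And>b b'. b \<in> Basis \<Longrightarrow> b' \<in> Basis \<Longrightarrow> ?e b' (\<xi> b) = (if b = b' then 1 else 0)"
      "\<And>v. v \<in> T q \<Longrightarrow> v = (\<Sum>b\<in>Basis. v (\<xi> b) *\<^sub>R ?e b)"
      by (rule coordinate_expansion[OF c q]) (rule that)
    \<comment> \<open>Independence is seen by evaluating on the dual functions \<open>\<xi> b\<close>.\<close>
    have inj: "inj_on ?e Basis"
    proof
      fix b b' :: 'e assume "b \<in> Basis" "b' \<in> Basis" "?e b = ?e b'"
      then show "b = b'" using \<xi>(1)[of b b] \<xi>(1)[of b b'] by (metis zero_neq_one)
    qed
    have "independent (?e ` Basis)"
    proof
      assume "dependent (?e ` Basis)"
      then obtain k b where sum0: "(\<Sum>x\<in>?e ` Basis. k x *\<^sub>R x) = 0"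
        and b: "b \<in> Basis" "k (?e b) \<noteq> 0"
        unfolding real_vector.dependent_finite[OF finite_imageI[OF finite_Basis]] by blast
      have "0 = (\<Sum>x\<in>?e ` Basis. k x *\<^sub>R x) (\<xi> b)" by (simp add: sum0)
      also have "\<dots> = (\<Sum>b'\<in>Basis. k (?e b') * ?e b' (\<xi> b))"
        by (simp add: sum_fun_apply scaleR_fun_def sum.reindex[OF inj])
      also have "\<dots> = (\<Sum>b'\<in>Basis. if b = b' then k (?e b') else 0)"
        by (intro sum.cong) (auto simp: \<xi>(1)[OF b(1)])
      also have "\<dots> = k (?e b)"
        using b(1) by simp
      finally show False using b(2) by simp
    qed
    moreover have "span (?e ` Basis) = T q"
    proof
      show "span (?e ` Basis) \<subseteq> T q"
        using coord_vec_tangent[OF c q] by (intro span_minimal subspace_tangent image_subsetI)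
      show "T q \<subseteq> span (?e ` Basis)"
      proof
        fix v assume "v \<in> T q"
        then have "v = (\<Sum>b\<in>Basis. v (\<xi> b) *\<^sub>R ?e b)" by (rule \<xi>(2))
        also have "\<dots> \<in> span (?e ` Basis)"
          by (intro span_sum span_scale span_base imageI)
        finally show "v \<in> span (?e ` Basis)" .
      qed
    qed
    ultimately show ?thesis
      using comp_inj_on[OF bij_betw_imp_inj_on[OF \<beta>], of ?e] inj
      by (simp add: im bij_betw_imp_surj_on[OF \<beta>] comp_def)
  qed
  then show "\<exists>U. open U \<and> p \<in> U \<and> (\<exists>X. (\<forall>i<DIM('e). X i \<in> local_sections A T U) \<and>
      (\<forall>q\<in>U. inj_on (\<lambda>i. X i q) {..<DIM('e)} \<and> independent ((\<lambda>i. X i q) ` {..<DIM('e)}) \<and>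
        span ((\<lambda>i. X i q) ` {..<DIM('e)}) = T q))"
    using p chart_open[OF c] coord_vec_local_section[OF c]
    by (intro exI[of _ U] conjI exI[of _ "\<lambda>i. coord_vec U \<phi> (\<beta> i)"]) auto
qed

section \<open>Smooth local sections and vector fields\<close>

lemma local_sections_cong:
  assumes "open U" "\<And>p. p \<in> U \<Longrightarrow> X p = Y p" "X \<in> local_sections A F U"
  shows "Y \<in> local_sections A F U"
  unfolding local_sections_def
proof (intro CollectI conjI ballI)
  show "Y p \<in> F p" if "p \<in> U" for p
    using assms(2)[OF that, symmetric] assms(3) that by (simp add: local_sections_def)
  show "smooth_fun_on A U (\<lambda>p. Y p f)" if "f \<in> C_inf A" for f
    by (rule smooth_fun_on_cong[OF assms(1), of "\<lambda>p. X p f"])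
      (use assms(2,3) that in \<open>auto simp: local_sections_def\<close>)
qed

lemma local_sections_tangent: "X \<in> local_sections A T U \<Longrightarrow> p \<in> U \<Longrightarrow> X p \<in> T p"
  by (simp add: local_sections_def)

lemma local_sections_smooth:
  "X \<in> local_sections A F U \<Longrightarrow> f \<in> C_inf A \<Longrightarrow> smooth_fun_on A U (\<lambda>p. X p f)"
  by (simp add: local_sections_def)

lemma local_sections_add:
  assumes "open U" "X \<in> local_sections A T U" "Y \<in> local_sections A T U"
  shows "(\<lambda>p. X p + Y p) \<in> local_sections A T U"
  using assms smooth_fun_on_add[OF assms(1)] subspace_add[OF subspace_tangent]
  by (simp add: local_sections_def)

lemma local_sections_scale:
  assumes "open U" "smooth_fun_on A U c" "X \<in> local_sections A T U"
  shows "(\<lambda>p. c p *\<^sub>R X p) \<in> local_sections A T U"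
  using assms smooth_fun_on_mult[OF assms(1,2)] subspace_scale[OF subspace_tangent]
  by (simp add: local_sections_def scaleR_fun_def)

lemma local_sections_diff:
  assumes "open U" "X \<in> local_sections A T U" "Y \<in> local_sections A T U"
  shows "(\<lambda>p. X p - Y p) \<in> local_sections A T U"
  using assms smooth_fun_on_diff[OF assms(1)] subspace_diff[OF subspace_tangent]
  by (simp add: local_sections_def)

lemma local_sections_sum:
  assumes "open U" "\<And>i. i \<in> I \<Longrightarrow> X i \<in> local_sections A T U"
  shows "(\<lambda>p. \<Sum>i\<in>I. X i p) \<in> local_sections A T U"
  unfolding local_sections_def
proof (intro CollectI conjI ballI)
  show "(\<Sum>i\<in>I. X i p) \<in> T p" if "p \<in> U" for p
    by (intro subspace_sum[OF subspace_tangent] local_sections_tangent[OF assms(2) that])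
  show "smooth_fun_on A U (\<lambda>p. (\<Sum>i\<in>I. X i p) f)" if "f \<in> C_inf A" for f
    unfolding sum_fun_apply
    by (intro smooth_fun_on_sum[OF assms(1)] local_sections_smooth[OF assms(2) that])
qed

lemma local_sections_subset:
  "X \<in> local_sections A F U \<Longrightarrow> V \<subseteq> U \<Longrightarrow> X \<in> local_sections A F V"
  unfolding local_sections_def by (auto intro: smooth_fun_on_subset)

lemma vector_field_local_section: "X \<in> vector_fields A \<Longrightarrow> X \<in> local_sections A T U"
  unfolding sections_def by (rule local_sections_subset) auto

text \<open>Smoothness may be checked locally and in the tangent bundle, the fibres pointwise.\<close>

lemma sections_localI:
  assumes "\<And>p. \<exists>U. open U \<and> p \<in> U \<and> X \<in> local_sections A T U" and "\<And>p. X p \<in> F p"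
  shows "X \<in> sections A F"
  unfolding sections_def local_sections_def
proof (intro CollectI conjI ballI)
  show "X p \<in> F p" for p by (rule assms(2))
  show "smooth_fun_on A UNIV (\<lambda>p. X p f)" if "f \<in> C_inf A" for f
  proof (rule smooth_fun_on_local)
    fix p
    obtain U where "open U" "p \<in> U" "X \<in> local_sections A T U" using assms(1) by blast
    then show "\<exists>V. open V \<and> p \<in> V \<and> smooth_fun_on A V (\<lambda>p. X p f)"
      using local_sections_smooth[of X T U f] that by (intro exI[of _ U]) simp
  qed
qed

lemma C_inf_open_nonzero:
  assumes "f \<in> C_inf A"
  shows "open {x. f x \<noteq> 0}"
proof (subst open_subopen, intro ballI)
  fix x assume x: "x \<in> {x. f x \<noteq> 0}"
  obtain U \<phi> where c: "(U, \<phi>) \<in> A" and xU: "x \<in> U" by (rule chart_cover)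
  have "Ck_on 0 (f \<circ> inv_into U \<phi>) (\<phi> ` U)"
    using C_inf_chart_smooth[OF assms c] unfolding smooth_on_def by blast
  then have "continuous_on U (\<lambda>y. (f \<circ> inv_into U \<phi>) (\<phi> y))"
    unfolding Ck_on.simps
    by (rule continuous_on_compose2[OF _ homeomorphism_cont1[OF chart_homeomorphism[OF c]]]) simp
  then have "continuous_on U f"
    by (rule continuous_on_eq) (simp add: chart_inv[OF c])
  then have "open (U \<inter> f -` (- {0}))"
    by (rule continuous_open_preimage) (auto simp: chart_open[OF c])
  then show "\<exists>V. open V \<and> x \<in> V \<and> V \<subseteq> {x. f x \<noteq> 0}"
    using x xU by (intro exI[of _ "U \<inter> f -` (- {0})"]) auto
qed

abbreviation VF :: "'m vfield set" where "VF \<equiv> vector_fields A"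

lemma vector_field_iff: "X \<in> VF \<longleftrightarrow> (\<forall>p. X p \<in> T p) \<and> (\<forall>f\<in>C_inf A. vf_apply X f \<in> C_inf A)"
  by (simp add: sections_def local_sections_def vf_apply_def C_inf_iff)

lemma vector_field_tangent: "X \<in> VF \<Longrightarrow> X p \<in> T p"
  and vf_apply_C_inf: "X \<in> VF \<Longrightarrow> f \<in> C_inf A \<Longrightarrow> vf_apply X f \<in> C_inf A"
  by (simp_all add: vector_field_iff)

lemma vector_field_add: "X \<in> VF \<Longrightarrow> Y \<in> VF \<Longrightarrow> X + Y \<in> VF"
  using local_sections_add[OF open_UNIV, of X Y] by (simp add: sections_def plus_fun_def)

lemma vector_field_diff: "X \<in> VF \<Longrightarrow> Y \<in> VF \<Longrightarrow> X - Y \<in> VF"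
  using local_sections_diff[OF open_UNIV, of X Y] by (simp add: sections_def fun_diff_def)

lemma vector_field_0: "0 \<in> VF"
  unfolding vector_field_iff by (simp add: vf_apply_def subspace_0[OF subspace_tangent])

lemma vector_field_scale: "f \<in> C_inf A \<Longrightarrow> X \<in> VF \<Longrightarrow> f \<odot> X \<in> VF"
  using local_sections_scale[OF open_UNIV, of f X] by (simp add: sections_def vf_scale_def C_inf_iff)

lemma vector_field_sum:
  assumes "\<And>i. i \<in> I \<Longrightarrow> X i \<in> VF"
  shows "(\<Sum>i\<in>I. X i) \<in> VF"
  using assms by (induction I rule: infinite_finite_induct) (auto intro: vector_field_0 vector_field_add)

lemma
  assumes "X \<in> VF" "f \<in> C_inf A" "h \<in> C_inf A"
  shows vf_apply_add: "vf_apply X (f + h) = vf_apply X f + vf_apply X h"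
    and vf_apply_mult: "vf_apply X (f * h) = f * vf_apply X h + h * vf_apply X f"
proof -
  note t = vector_field_tangent[OF assms(1)]
  show "vf_apply X (f + h) = vf_apply X f + vf_apply X h"
    by (rule ext) (simp add: vf_apply_def tangent_add[OF t assms(2,3)])
  show "vf_apply X (f * h) = f * vf_apply X h + h * vf_apply X f"
    by (rule ext) (simp add: vf_apply_def tangent_mult[OF t assms(2,3)])
qed

lemma vf_apply_nonsmooth: "X \<in> VF \<Longrightarrow> f \<notin> C_inf A \<Longrightarrow> vf_apply X f = 0"
  by (rule ext) (simp add: vf_apply_def tangent_nonsmooth[OF vector_field_tangent])

lemma vf_apply_scaleR: "X \<in> VF \<Longrightarrow> f \<in> C_inf A \<Longrightarrow> vf_apply X (c *\<^sub>R f) = c *\<^sub>R vf_apply X f"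
  by (rule ext) (simp add: vf_apply_def scaleR_fun_apply tangent_scaleR[OF vector_field_tangent])

lemma vf_apply_scale: "vf_apply (f \<odot> X) h = f * vf_apply X h"
  by (simp add: vf_apply_def vf_scale_def scaleR_fun_def times_fun_def)

lemma vf_apply_plus: "vf_apply (X + Y) h = vf_apply X h + vf_apply Y h"
  by (simp add: vf_apply_def plus_fun_def)

lemma vf_apply_lie_bracket:
  "vf_apply (lie_bracket X Y) f = vf_apply X (vf_apply Y f) - vf_apply Y (vf_apply X f)"
  by (simp add: vf_apply_def lie_bracket_def fun_diff_def)

lemma vf_eqI: "(\<And>f. vf_apply X f = vf_apply Y f) \<Longrightarrow> X = Y"
  unfolding vf_apply_def fun_eq_iff by blast

text \<open>The second-order terms in the Leibniz rule for \<open>X Y - Y X\<close> cancel.\<close>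

lemma lie_bracket_vector_field:
  assumes X: "X \<in> VF" and Y: "Y \<in> VF"
  shows "lie_bracket X Y \<in> VF"
proof -
  note C = vf_apply_C_inf[OF X] vf_apply_C_inf[OF Y]
  have ev: "lie_bracket X Y p f = (vf_apply X (vf_apply Y f) - vf_apply Y (vf_apply X f)) p" for p f
    by (simp add: vf_apply_def lie_bracket_def)
  have "lie_bracket X Y p \<in> T p" for p
    unfolding tangent_space_def
  proof (intro CollectI conjI ballI allI impI)
    fix f h assume f: "f \<in> C_inf A" and h: "h \<in> C_inf A"
    show "lie_bracket X Y p (f + h) = lie_bracket X Y p f + lie_bracket X Y p h"
      by (simp add: ev vf_apply_add X Y C f h)
    show "lie_bracket X Y p (c *\<^sub>R f) = c * lie_bracket X Y p f" for c
      by (simp add: ev vf_apply_scaleR X Y C f scaleR_fun_apply algebra_simps)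
    show "lie_bracket X Y p (f * h) = f p * lie_bracket X Y p h + h p * lie_bracket X Y p f"
      by (simp add: ev vf_apply_add vf_apply_mult X Y C C_inf_mult f h algebra_simps)
  next
    fix f assume "f \<notin> C_inf A"
    then have "lie_bracket X Y p f = (vf_apply X 0 - vf_apply Y 0) p"
      by (simp add: ev vf_apply_nonsmooth X Y)
    then show "lie_bracket X Y p f = 0"
      by (simp add: vf_apply_def tangent_0[OF vector_field_tangent] X Y)
  qed
  then show ?thesis
    by (simp add: vector_field_iff vf_apply_lie_bracket C_inf_diff C)
qed

lemma lie_bracket_swap: "lie_bracket X Y = - lie_bracket Y X"
  by (simp add: lie_bracket_def fun_eq_iff)

lemma lie_bracket_add_left:
  assumes "X \<in> VF" "Y \<in> VF" "Z \<in> VF"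
  shows "lie_bracket (X + Y) Z = lie_bracket X Z + lie_bracket Y Z"
proof (rule vf_eqI)
  fix f show "vf_apply (lie_bracket (X + Y) Z) f = vf_apply (lie_bracket X Z + lie_bracket Y Z) f"
  proof (cases "f \<in> C_inf A")
    case True
    then show ?thesis
      by (simp add: vf_apply_lie_bracket vf_apply_plus vf_apply_add assms vf_apply_C_inf algebra_simps)
  next
    case False
    then show ?thesis
      by (simp add: vf_apply_nonsmooth assms lie_bracket_vector_field vector_field_add)
  qed
qed

lemma lie_bracket_scale_right:
  assumes "X \<in> VF" "Y \<in> VF" "f \<in> C_inf A"
  shows "lie_bracket X (f \<odot> Y) = f \<odot> lie_bracket X Y + vf_apply X f \<odot> Y"
proof (rule vf_eqI)
  fix h show "vf_apply (lie_bracket X (f \<odot> Y)) h = vf_apply (f \<odot> lie_bracket X Y + vf_apply X f \<odot> Y) h"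
  proof (cases "h \<in> C_inf A")
    case True
    then show ?thesis
      by (simp add: vf_apply_lie_bracket vf_apply_plus vf_apply_scale vf_apply_mult assms vf_apply_C_inf
          algebra_simps)
  next
    case False
    then show ?thesis
      by (simp add: vf_apply_nonsmooth assms lie_bracket_vector_field vector_field_add vector_field_scale
          vf_apply_C_inf)
  qed
qed

end

section \<open>Orthogonal frames\<close>

locale riemannian_manifold = smooth_manifold A
  for A :: "('m::{t2_space, second_countable_topology}, 'e::euclidean_space) atlas" +
  fixes g :: "'m metric_tensor"
  assumes metric: "riemannian_metric A g"
begin

lemma
  assumes "u \<in> T p" "v \<in> T p"
  shows g_sym: "g p u v = g p v u"
    and g_add_left: "w \<in> T p \<Longrightarrow> g p (u + v) w = g p u w + g p v w"
    and g_scale_left: "g p (c *\<^sub>R u) v = c * g p u v"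
  using metric[unfolded riemannian_metric_def, THEN conjunct1, THEN spec, THEN bspec, OF assms(1),
      THEN bspec, OF assms(2)] by simp_all

lemma g_pos: "u \<in> T p \<Longrightarrow> u \<noteq> 0 \<Longrightarrow> g p u u > 0"
  using metric unfolding riemannian_metric_def by simp

lemma g_smooth:
  assumes "open U" "X \<in> local_sections A T U" "Y \<in> local_sections A T U"
  shows "smooth_fun_on A U (\<lambda>p. g p (X p) (Y p))"
proof -
  have "smooth_fun_on A U (metric_pair g X Y)"
    using metric assms unfolding riemannian_metric_def by blast
  then show ?thesis by (simp add: metric_pair_def)
qed

lemma g_zero_left: "v \<in> T p \<Longrightarrow> g p 0 v = 0"
  using g_scale_left[of v p v 0] by simp

lemma g_diff_left: "u \<in> T p \<Longrightarrow> v \<in> T p \<Longrightarrow> w \<in> T p \<Longrightarrow> g p (u - v) w = g p u w - g p v w"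
  using g_add_left[of u p "- v" w] g_scale_left[of v p w "- 1"] subspace_neg[OF subspace_tangent, of v p]
  by simp

lemma g_sum_left:
  assumes "w \<in> T p" "\<And>i. i \<in> I \<Longrightarrow> u i \<in> T p"
  shows "g p (\<Sum>i\<in>I. u i) w = (\<Sum>i\<in>I. g p (u i) w)"
  using assms(2)
proof (induction I rule: infinite_finite_induct)
  case (insert i I)
  have "(\<Sum>i\<in>I. u i) \<in> T p"
    by (rule subspace_sum[OF subspace_tangent]) (use insert.prems in simp)
  from g_add_left[OF insert.prems[OF insertI1] this assms(1)] insert.IH insert.prems
  show ?case by (simp only: sum.insert[OF insert.hyps] insertI2)
qed (simp_all add: g_zero_left assms(1))

lemma
  assumes "u \<in> T p" "v \<in> T p"
  shows g_add_right: "w \<in> T p \<Longrightarrow> g p w (u + v) = g p w u + g p w v"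
    and g_scale_right: "g p u (c *\<^sub>R v) = c * g p u v"
  using g_add_left[OF assms] g_scale_left[OF assms(2,1), of c]
    g_sym[of _ p w] g_sym[of _ p u] assms subspace_add[OF subspace_tangent assms]
    subspace_scale[OF subspace_tangent assms(2), of c]
  by metis+

lemma g_zero_right: "v \<in> T p \<Longrightarrow> g p v 0 = 0"
  using g_scale_right[of v p v 0] by simp

lemma g_eq_0: "u \<in> T p \<Longrightarrow> g p u u = 0 \<Longrightarrow> u = 0"
  using g_pos by force

text \<open>The basis vectors are not normalised: orthogonal frames then need only division by positive smooth
  functions, and no square roots.\<close>

definition orthogonal_basis :: "'m \<Rightarrow> nat \<Rightarrow> (nat \<Rightarrow> 'm tvec) \<Rightarrow> 'm tvec set \<Rightarrow> bool" where
  "orthogonal_basis q n e F \<longleftrightarrow>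
     (\<forall>i<n. e i \<in> T q \<and> g q (e i) (e i) > 0) \<and>
     (\<forall>i<n. \<forall>j<n. i \<noteq> j \<longrightarrow> g q (e i) (e j) = 0) \<and> span (e ` {..<n}) = F"

lemma orthogonal_basisD:
  assumes "orthogonal_basis q n e F"
  shows "i < n \<Longrightarrow> e i \<in> T q" "i < n \<Longrightarrow> g q (e i) (e i) > 0"
    "i < n \<Longrightarrow> j < n \<Longrightarrow> i \<noteq> j \<Longrightarrow> g q (e i) (e j) = 0" "span (e ` {..<n}) = F"
  using assms unfolding orthogonal_basis_def by auto

text \<open>The Fourier expansion of \<open>v\<close>, which is its orthogonal projection onto the span of the \<open>e i\<close>.\<close>

definition fourier :: "'m \<Rightarrow> nat \<Rightarrow> (nat \<Rightarrow> 'm tvec) \<Rightarrow> 'm tvec \<Rightarrow> 'm tvec" where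
  "fourier q n e v = (\<Sum>i<n. (g q v (e i) / g q (e i) (e i)) *\<^sub>R e i)"

lemma fourier_in_span:
  assumes "orthogonal_basis q n e F"
  shows "fourier q n e v \<in> F"
  unfolding fourier_def orthogonal_basisD(4)[OF assms, symmetric]
  by (intro span_sum span_scale span_base imageI)

lemma orthogonal_basis_subset: "orthogonal_basis q n e F \<Longrightarrow> F \<subseteq> T q"
  using span_minimal[OF _ subspace_tangent, of "e ` {..<n}" q] unfolding orthogonal_basis_def by auto

lemma fourier_orthogonal:
  assumes e: "orthogonal_basis q n e F" and v: "v \<in> T q" and u: "u \<in> F"
  shows "g q (v - fourier q n e v) u = 0"
proof -
  note eT = orthogonal_basisD(1)[OF e]
  let ?w = "fourier q n e v"
  have wT: "?w \<in> T q"
    using fourier_in_span[OF e] orthogonal_basis_subset[OF e] by auto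
  have dT: "v - ?w \<in> T q" by (rule subspace_diff[OF subspace_tangent v wT])
  have "g q (v - ?w) (e k) = 0" if k: "k < n" for k
  proof -
    have "g q ?w (e k) = (\<Sum>i<n. (g q v (e i) / g q (e i) (e i)) * g q (e i) (e k))"
      unfolding fourier_def
      by (subst g_sum_left) (auto simp: eT k g_scale_left subspace_scale[OF subspace_tangent])
    also have "\<dots> = (\<Sum>i<n. if i = k then g q v (e k) else 0)"
      using orthogonal_basisD(2)[OF e k] orthogonal_basisD(3)[OF e _ k] by (intro sum.cong) auto
    also have "\<dots> = g q v (e k)" using k by simp
    finally show ?thesis by (simp add: g_diff_left v wT eT k)
  qed
  moreover have "subspace {u \<in> T q. g q (v - ?w) u = 0}"
    unfolding subspace_def using subspace_tangent[of q]
    by (auto simp: g_zero_right g_add_right g_scale_right dT subspace_0 subspace_add subspace_scale)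
  ultimately have "span (e ` {..<n}) \<subseteq> {u \<in> T q. g q (v - ?w) u = 0}"
    using eT by (intro span_minimal) auto
  then show ?thesis using u orthogonal_basisD(4)[OF e] by auto
qed

lemma fourier_eq:
  assumes e: "orthogonal_basis q n e F" and v: "v \<in> F"
  shows "fourier q n e v = v"
proof -
  have FT: "F \<subseteq> T q" by (rule orthogonal_basis_subset[OF e])
  have "v - fourier q n e v \<in> F"
    using v fourier_in_span[OF e] subspace_span[of "e ` {..<n}"] orthogonal_basisD(4)[OF e]
    by (auto intro: subspace_diff)
  then have "v - fourier q n e v = 0"
    using FT fourier_orthogonal[OF e] v by (intro g_eq_0[of _ q]) auto
  then show ?thesis by simp
qed

lemma fourier_local_section:
  assumes U: "open U" and X: "X \<in> local_sections A T U"
    and e: "\<And>i. i < n \<Longrightarrow> e i \<in> local_sections A T U"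
      "\<And>q i. q \<in> U \<Longrightarrow> i < n \<Longrightarrow> g q (e i q) (e i q) > 0"
  shows "(\<lambda>q. fourier q n (\<lambda>i. e i q) (X q)) \<in> local_sections A T U"
  unfolding fourier_def
proof (intro local_sections_sum local_sections_scale smooth_fun_on_divide U g_smooth X)
  show "g q (e i q) (e i q) \<noteq> 0" if "i \<in> {..<n}" "q \<in> U" for i q
    using e(2)[of q i] that by simp
qed (use e(1) in auto)

text \<open>The Gram-Schmidt process carried out simultaneously at all points of \<open>U\<close>. Independence at every point
  keeps the new vector nonzero, so that the Fourier coefficients remain smooth.\<close>

lemma gram_schmidt:
  assumes U: "open U" and "\<And>i. i < n \<Longrightarrow> X i \<in> local_sections A T U"
    and "\<And>q. q \<in> U \<Longrightarrow> inj_on (\<lambda>i. X i q) {..<n} \<and> independent ((\<lambda>i. X i q) ` {..<n})"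
  shows "\<exists>e. (\<forall>i<n. e i \<in> local_sections A T U) \<and>
    (\<forall>q\<in>U. orthogonal_basis q n (\<lambda>i. e i q) (span ((\<lambda>i. X i q) ` {..<n})))"
  using assms(2,3)
proof (induction n)
  case 0
  then show ?case by (simp add: orthogonal_basis_def)
next
  case (Suc n)
  have "inj_on (\<lambda>i. X i q) {..<n} \<and> independent ((\<lambda>i. X i q) ` {..<n})" if "q \<in> U" for q
    using Suc.prems(2)[OF that] lessThan_subset_iff[of n "Suc n"]
    by (meson image_mono independent_mono inj_on_subset le_Suc_eq order_refl)
  from Suc.IH[OF Suc.prems(1)[OF less_SucI] this]
  obtain e where e: "\<And>i. i < n \<Longrightarrow> e i \<in> local_sections A T U"
    and ob: "\<And>q. q \<in> U \<Longrightarrow> orthogonal_basis q n (\<lambda>i. e i q) (span ((\<lambda>i. X i q) ` {..<n}))"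
    by blast
  define N where "N q = X n q - fourier q n (\<lambda>i. e i q) (X n q)" for q
  have XN: "X n \<in> local_sections A T U" by (rule Suc.prems(1)) simp
  have NS: "N \<in> local_sections A T U"
    unfolding N_def
    by (intro local_sections_diff[OF U XN] fourier_local_section[OF U XN e] orthogonal_basisD(2)[OF ob])
  define e' where "e' = e(n := N)"
  have e'S: "e' i \<in> local_sections A T U" if "i < Suc n" for i
    using that e NS by (auto simp: e'_def less_Suc_eq)
  have "orthogonal_basis q (Suc n) (\<lambda>i. e' i q) (span ((\<lambda>i. X i q) ` {..<Suc n}))" if q: "q \<in> U" for q
  proof -
    let ?S = "(\<lambda>i. X i q) ` {..<n}" and ?R = "(\<lambda>i. e i q) ` {..<n}"
    note o = ob[OF q]
    have span_eq: "span ?R = span ?S" by (rule orthogonal_basisD(4)[OF o])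
    have eT: "i < n \<Longrightarrow> e i q \<in> T q" for i by (rule local_sections_tangent[OF e q])
    have XT: "X n q \<in> T q" by (rule local_sections_tangent[OF XN q])
    have NT: "N q \<in> T q" by (rule local_sections_tangent[OF NS q])
    have F: "fourier q n (\<lambda>i. e i q) (X n q) \<in> span ?S" by (rule fourier_in_span[OF o])
    have "X n q \<notin> ?S"
      using Suc.prems(2)[OF q] by (auto simp: lessThan_Suc)
    then have "X n q \<notin> span ?S"
      using Suc.prems(2)[OF q] by (simp add: lessThan_Suc independent_insert)
    then have "N q \<noteq> 0" using F by (auto simp: N_def)
    then have pos: "g q (N q) (N q) > 0" by (rule g_pos[OF NT])
    have orth: "g q (N q) (e i q) = 0" "g q (e i q) (N q) = 0" if "i < n" for i
    proof -
      have "e i q \<in> span ?S" unfolding span_eq[symmetric] using that by (intro span_base) auto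
      then show "g q (N q) (e i q) = 0" unfolding N_def by (rule fourier_orthogonal[OF o XT])
      then show "g q (e i q) (N q) = 0" using g_sym[OF NT eT[OF that]] by simp
    qed
    have im: "(\<lambda>i. e' i q) ` {..<Suc n} = insert (N q) ?R"
      by (auto simp: e'_def lessThan_Suc)
    have "span (insert (N q) ?R) = span (insert (X n q) ?R)"
      using F span_eq by (intro eq_span_insert_eq) (simp add: N_def span_neg)
    also have "\<dots> = span (insert (X n q) ?S)"
      by (simp only: span_insert span_eq)
    finally have "span ((\<lambda>i. e' i q) ` {..<Suc n}) = span ((\<lambda>i. X i q) ` {..<Suc n})"
      unfolding im by (simp add: lessThan_Suc)
    then show ?thesis
      unfolding orthogonal_basis_def
      using pos orth NT eT orthogonal_basisD(2,3)[OF o]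
      by (auto simp: e'_def less_Suc_eq)
  qed
  then show ?case using e'S by (intro exI[of _ e']) blast
qed

lemma orthogonal_frame:
  assumes "distribution A n F"
  obtains U e where "open U" "p \<in> U" "\<And>i. i < n \<Longrightarrow> e i \<in> local_sections A T U"
    "\<And>q. q \<in> U \<Longrightarrow> orthogonal_basis q n (\<lambda>i. e i q) (F q)"
proof -
  have FT: "F q \<subseteq> T q" for q using assms unfolding distribution_def by blast
  obtain U X where U: "open U" "p \<in> U" and X: "\<forall>i<n. X i \<in> local_sections A F U"
    and b: "\<forall>q\<in>U. inj_on (\<lambda>i. X i q) {..<n} \<and> independent ((\<lambda>i. X i q) ` {..<n}) \<and>
                  span ((\<lambda>i. X i q) ` {..<n}) = F q"
    using assms[unfolded distribution_def, THEN conjunct2, THEN spec, of p]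
    by (elim exE conjE) (rule that)
  have XT: "X i \<in> local_sections A T U" if "i < n" for i
    using X that FT unfolding local_sections_def by blast
  have "inj_on (\<lambda>i. X i q) {..<n} \<and> independent ((\<lambda>i. X i q) ` {..<n})" if "q \<in> U" for q
    using b that by simp
  from gram_schmidt[OF U(1) XT this]
  obtain e where "\<forall>i<n. e i \<in> local_sections A T U"
    "\<forall>q\<in>U. orthogonal_basis q n (\<lambda>i. e i q) (span ((\<lambda>i. X i q) ` {..<n}))"
    by blast
  then show thesis using U b by (intro that[of U e]) auto
qed

section \<open>Duality between fields and functionals\<close>

lemma metric_pair_C_inf: "X \<in> VF \<Longrightarrow> Y \<in> VF \<Longrightarrow> metric_pair g X Y \<in> C_inf A"
  using g_smooth[OF open_UNIV] unfolding C_inf_iff sections_def metric_pair_def by blast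

lemma metric_pair_sym: "X \<in> VF \<Longrightarrow> Y \<in> VF \<Longrightarrow> metric_pair g X Y = metric_pair g Y X"
  by (rule ext) (simp add: metric_pair_def g_sym[OF vector_field_tangent vector_field_tangent])

lemma metric_pair_add_left:
  "X \<in> VF \<Longrightarrow> Y \<in> VF \<Longrightarrow> Z \<in> VF \<Longrightarrow> metric_pair g (X + Y) Z = metric_pair g X Z + metric_pair g Y Z"
  by (rule ext) (simp add: metric_pair_def g_add_left vector_field_tangent)

lemma metric_pair_diff_left:
  "X \<in> VF \<Longrightarrow> Y \<in> VF \<Longrightarrow> Z \<in> VF \<Longrightarrow> metric_pair g (X - Y) Z = metric_pair g X Z - metric_pair g Y Z"
  by (rule ext) (simp add: metric_pair_def g_diff_left vector_field_tangent)

lemma metric_pair_scale_left: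
  "X \<in> VF \<Longrightarrow> Z \<in> VF \<Longrightarrow> metric_pair g (f \<odot> X) Z = f * metric_pair g X Z"
  by (rule ext) (simp add: metric_pair_def vf_scale_def g_scale_left vector_field_tangent)

lemma metric_pair_add_right:
  "X \<in> VF \<Longrightarrow> Y \<in> VF \<Longrightarrow> Z \<in> VF \<Longrightarrow> metric_pair g Z (X + Y) = metric_pair g Z X + metric_pair g Z Y"
  by (rule ext) (simp add: metric_pair_def g_add_right vector_field_tangent)

lemma metric_pair_scale_right:
  "X \<in> VF \<Longrightarrow> Z \<in> VF \<Longrightarrow> metric_pair g Z (f \<odot> X) = f * metric_pair g Z X"
  by (rule ext) (simp add: metric_pair_def vf_scale_def g_scale_right vector_field_tangent)

lemma metric_pair_0_left: "X \<in> VF \<Longrightarrow> metric_pair g 0 X = 0"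
  by (rule ext) (simp add: metric_pair_def g_zero_left vector_field_tangent)

lemma metric_pair_nondegenerate:
  assumes "W \<in> VF" "W' \<in> VF" "\<And>Z. Z \<in> VF \<Longrightarrow> metric_pair g W Z = metric_pair g W' Z"
  shows "W = W'"
proof
  fix p
  have D: "W - W' \<in> VF" by (rule vector_field_diff[OF assms(1,2)])
  have "metric_pair g (W - W') (W - W') = 0"
    using assms(3)[OF D] by (simp add: metric_pair_diff_left[OF assms(1,2) D])
  then have "g p (W p - W' p) (W p - W' p) = 0"
    by (simp add: metric_pair_def fun_eq_iff)
  then have "W p - W' p = 0"
    using vector_field_tangent[OF D, of p] by (intro g_eq_0[of _ p]) simp_all
  then show "W p = W' p" by simp
qed

text \<open>The sections are local frame sections multiplied by a cutoff \<open>\<kappa>\<close>; they still form an orthogonal frame on the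
  open set where \<open>\<kappa>\<close> does not vanish.\<close>

lemma global_orthogonal_frame:
  obtains V e where "open V" "p \<in> V" "\<And>i. i < DIM('e) \<Longrightarrow> e i \<in> VF"
    "\<And>q. q \<in> V \<Longrightarrow> orthogonal_basis q DIM('e) (\<lambda>i. e i q) (T q)"
proof -
  let ?n = "DIM('e)"
  obtain U e where U: "open U" "p \<in> U" and e: "\<And>i. i < ?n \<Longrightarrow> e i \<in> local_sections A T U"
    and ob: "\<And>q. q \<in> U \<Longrightarrow> orthogonal_basis q ?n (\<lambda>i. e i q) (T q)"
    by (rule orthogonal_frame[OF tangent_distribution]) (rule that)
  obtain \<kappa> where \<kappa>: "\<kappa> \<in> C_inf A" "\<kappa> p = 1" "\<And>q. q \<notin> U \<Longrightarrow> \<kappa> q = 0"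
    "\<And>f. smooth_fun_on A U f \<Longrightarrow> \<kappa> * f \<in> C_inf A"
    by (rule cutoff[OF U]) (rule that)
  show thesis
  proof (rule that[of "{q. \<kappa> q \<noteq> 0}" "\<lambda>i. \<kappa> \<odot> e i"])
    show "open {q. \<kappa> q \<noteq> 0}" by (rule C_inf_open_nonzero[OF \<kappa>(1)])
    show "p \<in> {q. \<kappa> q \<noteq> 0}" using \<kappa>(2) by simp
    show "\<kappa> \<odot> e i \<in> VF" if i: "i < ?n" for i
      unfolding vector_field_iff
    proof (intro conjI allI ballI)
      show "(\<kappa> \<odot> e i) q \<in> T q" for q
        by (cases "q \<in> U") (auto simp: vf_scale_def \<kappa>(3) subspace_0[OF subspace_tangent]
            intro: subspace_scale[OF subspace_tangent] local_sections_tangent[OF e[OF i]])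
      show "vf_apply (\<kappa> \<odot> e i) f \<in> C_inf A" if "f \<in> C_inf A" for f
        unfolding vf_apply_scale unfolding vf_apply_def
        by (rule \<kappa>(4)[OF local_sections_smooth[OF e[OF i] that]])
    qed
    fix q assume "q \<in> {q. \<kappa> q \<noteq> 0}"
    then have q: "q \<in> U" "\<kappa> q \<noteq> 0" using \<kappa>(3) by auto
    note o = ob[OF q(1)]
    note eT = orthogonal_basisD(1)[OF o]
    have "(\<lambda>i. (\<kappa> \<odot> e i) q) ` {..<?n} = (\<lambda>v. \<kappa> q *\<^sub>R v) ` (\<lambda>i. e i q) ` {..<?n}"
      by (simp add: image_image vf_scale_def)
    also have "span \<dots> = T q"
      using q(2) orthogonal_basisD(4)[OF o] by (subst span_image_scale) auto
    finally have "span ((\<lambda>i. (\<kappa> \<odot> e i) q) ` {..<?n}) = T q" .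
    moreover have "0 < \<kappa> q * (\<kappa> q * g q (e i q) (e i q))" if "i < ?n" for i
      using orthogonal_basisD(2)[OF o that] q(2)
      by (simp flip: mult.assoc power2_eq_square)
    ultimately show "orthogonal_basis q ?n (\<lambda>i. (\<kappa> \<odot> e i) q) (T q)"
      unfolding orthogonal_basis_def
      using eT orthogonal_basisD(3)[OF o] subspace_scale[OF subspace_tangent eT]
      by (simp add: vf_scale_def g_scale_left g_scale_right)
  qed
qed

definition C_inf_linear :: "('m vfield \<Rightarrow> 'm \<Rightarrow> real) \<Rightarrow> bool" where
  "C_inf_linear K \<longleftrightarrow>
     (\<forall>Z\<in>VF. K Z \<in> C_inf A) \<and>
     (\<forall>Z\<in>VF. \<forall>Z'\<in>VF. K (Z + Z') = K Z + K Z') \<and>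
     (\<forall>f\<in>C_inf A. \<forall>Z\<in>VF. K (f \<odot> Z) = f * K Z)"

lemma C_inf_linear_sum:
  assumes K: "C_inf_linear K" and "\<And>i. i \<in> I \<Longrightarrow> X i \<in> VF"
  shows "K (\<Sum>i\<in>I. X i) = (\<Sum>i\<in>I. K (X i))"
proof -
  have "K (0 + 0) = K 0 + K 0" using K vector_field_0 unfolding C_inf_linear_def by blast
  then have K0: "K 0 = 0" by simp
  show ?thesis
    using assms(2)
  proof (induction I rule: infinite_finite_induct)
    case (insert i I)
    have "K (X i + (\<Sum>i\<in>I. X i)) = K (X i) + K (\<Sum>i\<in>I. X i)"
      using K insert.prems vector_field_sum[of I X] unfolding C_inf_linear_def by simp
    then show ?case
      using insert.IH insert.prems by (simp only: sum.insert[OF insert.hyps] insertI2)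
  qed (simp_all add: K0)
qed

text \<open>The functional sees only the value of \<open>Z\<close> at \<open>q\<close>: near \<open>q\<close> the field is a combination of the \<open>e i\<close> with smooth
  coefficients. After multiplication by a cutoff this becomes an identity of global fields, to which linearity
  applies.\<close>

lemma C_inf_linear_expansion:
  assumes K: "C_inf_linear K" and V: "open V" "q \<in> V"
    and e: "\<And>i. i < n \<Longrightarrow> e i \<in> VF" "\<And>q. q \<in> V \<Longrightarrow> orthogonal_basis q n (\<lambda>i. e i q) (T q)"
    and Z: "Z \<in> VF"
  shows "K Z q = (\<Sum>i<n. g q (Z q) (e i q) / g q (e i q) (e i q) * K (e i) q)"
proof -
  define c where "c i q = g q (Z q) (e i q) / g q (e i q) (e i q)" for i q
  obtain \<kappa> where \<kappa>: "\<kappa> \<in> C_inf A" "\<kappa> q = 1" "\<And>q. q \<notin> V \<Longrightarrow> \<kappa> q = 0"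
    "\<And>f. smooth_fun_on A V f \<Longrightarrow> \<kappa> * f \<in> C_inf A"
    by (rule cutoff[OF V]) (rule that)
  have c: "\<kappa> * c i \<in> C_inf A" if "i < n" for i
    unfolding c_def
  proof (intro \<kappa>(4) smooth_fun_on_divide V g_smooth vector_field_local_section Z e(1) that)
    show "g x (e i x) (e i x) \<noteq> 0" if "x \<in> V" for x
      using orthogonal_basisD(2)[OF e(2)[OF that] \<open>i < n\<close>] by simp
  qed
  have "\<kappa> \<odot> Z = (\<Sum>i<n. (\<kappa> * c i) \<odot> e i)"
  proof
    fix x
    show "(\<kappa> \<odot> Z) x = (\<Sum>i<n. (\<kappa> * c i) \<odot> e i) x"
    proof (cases "x \<in> V")
      case True
      have "Z x = (\<Sum>i<n. c i x *\<^sub>R e i x)"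
        using fourier_eq[OF e(2)[OF True] vector_field_tangent[OF Z]] by (simp add: fourier_def c_def)
      then have "\<kappa> x *\<^sub>R Z x = (\<Sum>i<n. (\<kappa> x * c i x) *\<^sub>R e i x)"
        by (simp only: scaleR_sum_right scaleR_scaleR)
      then show ?thesis by (simp only: sum_fun_apply vf_scale_def times_fun_apply)
    next
      case False
      then show ?thesis by (simp add: sum_fun_apply vf_scale_def \<kappa>(3))
    qed
  qed
  then have "K (\<kappa> \<odot> Z) = (\<Sum>i<n. K ((\<kappa> * c i) \<odot> e i))"
    by (simp only:) (rule C_inf_linear_sum[OF K], use c e(1) vector_field_scale in simp)
  moreover have "K (\<kappa> \<odot> Z) = \<kappa> * K Z"
    using K \<kappa>(1) Z unfolding C_inf_linear_def by blast
  moreover have "K ((\<kappa> * c i) \<odot> e i) = (\<kappa> * c i) * K (e i)" if "i < n" for i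
    using K c[OF that] e(1)[OF that] unfolding C_inf_linear_def by blast
  ultimately have "\<kappa> * K Z = (\<Sum>i<n. (\<kappa> * c i) * K (e i))"
    by (metis (no_types, lifting) lessThan_iff sum.cong)
  then have "(\<kappa> * K Z) q = (\<Sum>i<n. (\<kappa> * c i) * K (e i)) q" by (rule arg_cong)
  then show ?thesis by (simp add: sum_fun_apply \<kappa>(2) c_def)
qed

text \<open>At each point the vector is given by the components of \<open>K\<close> in an orthogonal frame. It is independent of
  the frame, since a vector is determined by its products with the values of global fields. Hence the local
  formulas agree where they overlap, and the vectors form a smooth field.\<close>

lemma riesz:
  assumes K: "C_inf_linear K"
  shows "\<exists>W\<in>VF. \<forall>Z\<in>VF. metric_pair g W Z = K Z"
proof -
  let ?n = "DIM('e)"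
  define good where "good p w \<longleftrightarrow> w \<in> T p \<and> (\<forall>Z\<in>VF. g p w (Z p) = K Z p)" for p w
  define R where "R e q = (\<Sum>i<?n. (K (e i) q / g q (e i q) (e i q)) *\<^sub>R e i q)"
    for e :: "nat \<Rightarrow> 'm vfield" and q
  have good_R: "good q (R e q)"
    if V: "open V" "q \<in> V" and e: "\<And>i. i < ?n \<Longrightarrow> e i \<in> VF"
      "\<And>q. q \<in> V \<Longrightarrow> orthogonal_basis q ?n (\<lambda>i. e i q) (T q)" for V e q
    unfolding good_def
  proof (intro conjI ballI)
    note eT = orthogonal_basisD(1)[OF e(2)[OF V(2)]]
    show "R e q \<in> T q"
      unfolding R_def by (intro subspace_sum subspace_scale subspace_tangent) (use eT in simp)
    fix Z assume Z: "Z \<in> VF"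
    have "g q (R e q) (Z q) = (\<Sum>i<?n. K (e i) q / g q (e i q) (e i q) * g q (e i q) (Z q))"
      unfolding R_def
      by (subst g_sum_left)
        (auto simp: vector_field_tangent[OF Z] eT g_scale_left subspace_scale[OF subspace_tangent])
    also have "\<dots> = (\<Sum>i<?n. g q (Z q) (e i q) / g q (e i q) (e i q) * K (e i) q)"
      by (intro sum.cong) (use g_sym[OF eT vector_field_tangent[OF Z]] in auto)
    also have "\<dots> = K Z q"
      by (rule C_inf_linear_expansion[OF K V e Z, symmetric])
    finally show "g q (R e q) (Z q) = K Z q" .
  qed
  have unique: "w = w'" if w: "good p w" "good p w'" for p w w'
  proof -
    obtain V e where V: "open V" "p \<in> V" and e: "\<And>i. i < ?n \<Longrightarrow> e i \<in> VF"
      "\<And>q. q \<in> V \<Longrightarrow> orthogonal_basis q ?n (\<lambda>i. e i q) (T q)"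
      by (rule global_orthogonal_frame) (rule that)
    have wT: "w \<in> T p" "w' \<in> T p" using w by (auto simp: good_def)
    have "g p w (e i p) = g p w' (e i p)" if "i < ?n" for i
      using w e(1)[OF that] by (simp add: good_def)
    then have "fourier p ?n (\<lambda>i. e i p) w = fourier p ?n (\<lambda>i. e i p) w'"
      unfolding fourier_def by (intro sum.cong) auto
    then show ?thesis
      using fourier_eq[OF e(2)[OF V(2)] wT(1)] fourier_eq[OF e(2)[OF V(2)] wT(2)] by simp
  qed
  define W where "W p = (SOME w. good p w)" for p
  have W: "good p (W p)" for p
  proof -
    obtain V e where V: "open V" "p \<in> V" and e: "\<And>i. i < ?n \<Longrightarrow> e i \<in> VF"
      "\<And>q. q \<in> V \<Longrightarrow> orthogonal_basis q ?n (\<lambda>i. e i q) (T q)"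
      by (rule global_orthogonal_frame) (rule that)
    show ?thesis unfolding W_def by (rule someI[of "good p"], rule good_R[OF V e])
  qed
  have "W \<in> VF"
  proof (rule sections_localI)
    show "W p \<in> T p" for p using W by (simp add: good_def)
    fix p
    obtain V e where V: "open V" "p \<in> V" and e: "\<And>i. i < ?n \<Longrightarrow> e i \<in> VF"
      and ob: "\<And>q. q \<in> V \<Longrightarrow> orthogonal_basis q ?n (\<lambda>i. e i q) (T q)"
      by (rule global_orthogonal_frame) (rule that)
    have "R e \<in> local_sections A T V"
      unfolding R_def
    proof (intro local_sections_sum local_sections_scale smooth_fun_on_divide V g_smooth
        vector_field_local_section e C_inf_smooth_fun_on)
      show "K (e i) \<in> C_inf A" if "i \<in> {..<?n}" for i
        using K e that unfolding C_inf_linear_def by simp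
      show "g q (e i q) (e i q) \<noteq> 0" if "i \<in> {..<?n}" "q \<in> V" for i q
        using orthogonal_basisD(2)[OF ob[OF that(2)], of i] that(1) by simp
    qed auto
    moreover have "R e q = W q" if "q \<in> V" for q
      by (rule unique[OF good_R[OF V(1) that e ob] W])
    ultimately have "W \<in> local_sections A T V"
      by (intro local_sections_cong[OF V(1), of "R e" W])
    then show "\<exists>U. open U \<and> p \<in> U \<and> W \<in> local_sections A T U"
      using V by (intro exI[of _ V]) simp
  qed
  moreover have "metric_pair g W Z = K Z" if "Z \<in> VF" for Z
    using W that by (auto simp: good_def metric_pair_def)
  ultimately show ?thesis by (intro bexI[of _ W]) auto
qed

section \<open>Orthogonal projection onto a distribution\<close>

definition proj :: "('m \<Rightarrow> 'm tvec set) \<Rightarrow> 'm vfield \<Rightarrow> 'm vfield" where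
  "proj F X p = (THE w. w \<in> F p \<and> (\<forall>u\<in>F p. g p (X p - w) u = 0))"

context
  fixes F n
  assumes F: "distribution A n F"
begin

lemma distribution_subspace: "subspace (F p)"
  and distribution_tangent: "F p \<subseteq> T p"
  using F unfolding distribution_def by blast+

text \<open>The vector in the definition is unique: the difference of two candidates lies in \<open>F p\<close> and is orthogonal
  to \<open>F p\<close>.\<close>

lemma proj_eqI:
  assumes "X p \<in> T p" "w \<in> F p" "\<And>u. u \<in> F p \<Longrightarrow> g p (X p - w) u = 0"
  shows "proj F X p = w"
  unfolding proj_def
proof (rule the_equality)
  show "w \<in> F p \<and> (\<forall>u\<in>F p. g p (X p - w) u = 0)" using assms by blast
  fix w' assume w': "w' \<in> F p \<and> (\<forall>u\<in>F p. g p (X p - w') u = 0)"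
  have T: "X p \<in> T p" "w \<in> T p" "w' \<in> T p" using assms w' distribution_tangent by auto
  have d: "w' - w \<in> F p" using w' assms(2) distribution_subspace by (simp add: subspace_diff)
  then have dT: "w' - w \<in> T p" using distribution_tangent by auto
  have "g p (w' - w) (w' - w) = g p (X p - w) (w' - w) - g p (X p - w') (w' - w)"
    by (simp add: g_diff_left T dT)
  also have "\<dots> = 0" using assms(3)[OF d] w' d by simp
  finally have "w' - w = 0" by (rule g_eq_0[OF dT])
  then show "w' = w" by simp
qed

lemma proj_fourier:
  "orthogonal_basis p n e (F p) \<Longrightarrow> X p \<in> T p \<Longrightarrow> proj F X p = fourier p n e (X p)"
  by (intro proj_eqI fourier_in_span fourier_orthogonal)

text \<open>In a smooth orthogonal frame the projection is a Fourier expansion, hence smooth.\<close>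

lemma proj_section:
  assumes X: "X \<in> VF"
  shows "proj F X \<in> sections A F"
proof (rule sections_localI)
  fix p
  obtain U e where U: "open U" "p \<in> U" and e: "\<And>i. i < n \<Longrightarrow> e i \<in> local_sections A T U"
    and ob: "\<And>q. q \<in> U \<Longrightarrow> orthogonal_basis q n (\<lambda>i. e i q) (F q)"
    by (rule orthogonal_frame[OF F]) (rule that)
  have eq: "proj F X q = fourier q n (\<lambda>i. e i q) (X q)" if "q \<in> U" for q
    using ob[OF that] vector_field_tangent[OF X] by (rule proj_fourier)
  show "proj F X p \<in> F p"
    unfolding eq[OF U(2)] by (rule fourier_in_span[OF ob[OF U(2)]])
  have "(\<lambda>q. fourier q n (\<lambda>i. e i q) (X q)) \<in> local_sections A T U"
    by (rule fourier_local_section[OF U(1) vector_field_local_section[OF X] e orthogonal_basisD(2)[OF ob]])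
  then have "proj F X \<in> local_sections A T U"
    using local_sections_cong[OF U(1), of "\<lambda>q. fourier q n (\<lambda>i. e i q) (X q)" "proj F X"] eq
    by simp
  then show "\<exists>U. open U \<and> p \<in> U \<and> proj F X \<in> local_sections A T U"
    using U by (intro exI[of _ U]) simp
qed

end

section \<open>Metric connections with prescribed torsion\<close>

text \<open>Pairing the bracket with a third field moves the computations from fields to the commutative ring of
  functions, where ring normalisation applies.\<close>

definition bracket_pair :: "'m vfield \<Rightarrow> 'm vfield \<Rightarrow> 'm vfield \<Rightarrow> 'm \<Rightarrow> real" where
  "bracket_pair X Y Z = metric_pair g (lie_bracket X Y) Z"

lemma bracket_pair_swap:
  assumes "X \<in> VF" "Y \<in> VF" "Z \<in> VF"
  shows "bracket_pair X Y Z = - bracket_pair Y X Z"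
proof -
  have "lie_bracket X Y = 0 - lie_bracket Y X" by (subst lie_bracket_swap) simp
  then have "bracket_pair X Y Z = metric_pair g (0 - lie_bracket Y X) Z"
    by (simp only: bracket_pair_def)
  also have "\<dots> = metric_pair g 0 Z - bracket_pair Y X Z"
    unfolding bracket_pair_def
    by (intro metric_pair_diff_left vector_field_0 lie_bracket_vector_field assms)
  finally show ?thesis by (simp add: metric_pair_0_left assms)
qed

lemma bracket_pair_C_inf:
  "X \<in> VF \<Longrightarrow> Y \<in> VF \<Longrightarrow> Z \<in> VF \<Longrightarrow> bracket_pair X Y Z \<in> C_inf A"
  by (simp add: bracket_pair_def metric_pair_C_inf lie_bracket_vector_field)

lemma bracket_pair_add:
  assumes "X \<in> VF" "Y \<in> VF" "Z \<in> VF" "W \<in> VF"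
  shows "bracket_pair (X + W) Y Z = bracket_pair X Y Z + bracket_pair W Y Z"
    and "bracket_pair X (Y + W) Z = bracket_pair X Y Z + bracket_pair X W Z"
    and "bracket_pair X Y (Z + W) = bracket_pair X Y Z + bracket_pair X Y W"
proof -
  have *: "bracket_pair (X + W) Y Z = bracket_pair X Y Z + bracket_pair W Y Z"
    if "X \<in> VF" "Y \<in> VF" "Z \<in> VF" "W \<in> VF" for X Y Z W
    by (simp add: bracket_pair_def lie_bracket_add_left metric_pair_add_left lie_bracket_vector_field that)
  show "bracket_pair (X + W) Y Z = bracket_pair X Y Z + bracket_pair W Y Z" by (rule *[OF assms])
  show "bracket_pair X (Y + W) Z = bracket_pair X Y Z + bracket_pair X W Z"
    using *[of Y X Z W] bracket_pair_swap[of X "Y + W" Z] bracket_pair_swap[of X Y Z]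
      bracket_pair_swap[of X W Z] by (simp add: assms vector_field_add)
  show "bracket_pair X Y (Z + W) = bracket_pair X Y Z + bracket_pair X Y W"
    by (simp add: bracket_pair_def metric_pair_add_right lie_bracket_vector_field assms)
qed

lemma bracket_pair_scale:
  assumes "X \<in> VF" "Y \<in> VF" "Z \<in> VF" "f \<in> C_inf A"
  shows "bracket_pair (f \<odot> X) Y Z = f * bracket_pair X Y Z - vf_apply Y f * metric_pair g X Z"
    and "bracket_pair X (f \<odot> Y) Z = f * bracket_pair X Y Z + vf_apply X f * metric_pair g Y Z"
    and "bracket_pair X Y (f \<odot> Z) = f * bracket_pair X Y Z"
proof -
  have *: "bracket_pair X (f \<odot> Y) Z = f * bracket_pair X Y Z + vf_apply X f * metric_pair g Y Z"
    if "X \<in> VF" "Y \<in> VF" "Z \<in> VF" for X Y Z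
    by (simp add: bracket_pair_def lie_bracket_scale_right metric_pair_add_left metric_pair_scale_left
        lie_bracket_vector_field vector_field_scale vf_apply_C_inf that assms(4))
  show "bracket_pair X (f \<odot> Y) Z = f * bracket_pair X Y Z + vf_apply X f * metric_pair g Y Z"
    by (rule *[OF assms(1-3)])
  show "bracket_pair (f \<odot> X) Y Z = f * bracket_pair X Y Z - vf_apply Y f * metric_pair g X Z"
    using *[of Y X Z] bracket_pair_swap[of "f \<odot> X" Y Z] bracket_pair_swap[of X Y Z]
    by (simp add: assms vector_field_scale)
  show "bracket_pair X Y (f \<odot> Z) = f * bracket_pair X Y Z"
    by (simp add: bracket_pair_def metric_pair_scale_right lie_bracket_vector_field assms)
qed

lemma affine_connection_vector_field: "affine_connection A D \<Longrightarrow> X \<in> VF \<Longrightarrow> Y \<in> VF \<Longrightarrow> D X Y \<in> VF"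
  unfolding affine_connection_def by simp

lemma torsion_vector_field:
  "D X Y \<in> VF \<Longrightarrow> D Y X \<in> VF \<Longrightarrow> X \<in> VF \<Longrightarrow> Y \<in> VF \<Longrightarrow> torsion D X Y \<in> VF"
  unfolding torsion_def by (intro vector_field_diff lie_bracket_vector_field)

lemma torsion_pair:
  "D X Y \<in> VF \<Longrightarrow> D Y X \<in> VF \<Longrightarrow> X \<in> VF \<Longrightarrow> Y \<in> VF \<Longrightarrow> Z \<in> VF \<Longrightarrow>
    metric_pair g (torsion D X Y) Z = metric_pair g (D X Y) Z - metric_pair g (D Y X) Z - bracket_pair X Y Z"
  unfolding torsion_def bracket_pair_def
  by (simp add: metric_pair_diff_left vector_field_diff lie_bracket_vector_field)

text \<open>The forms \<open>g(\<tau>(X, Y), Z)\<close> of torsion tensors \<open>\<tau>\<close>. Linearity in the second argument follows by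
  antisymmetry.\<close>

definition torsion_form :: "('m vfield \<Rightarrow> 'm vfield \<Rightarrow> 'm vfield \<Rightarrow> 'm \<Rightarrow> real) \<Rightarrow> bool" where
  "torsion_form \<Theta> \<longleftrightarrow>
     (\<forall>X\<in>VF. \<forall>Y\<in>VF. \<forall>Z\<in>VF. \<Theta> X Y Z = - \<Theta> Y X Z) \<and>
     (\<forall>X\<in>VF. \<forall>Y\<in>VF. C_inf_linear (\<Theta> X Y)) \<and>
     (\<forall>Y\<in>VF. \<forall>Z\<in>VF. C_inf_linear (\<lambda>X. \<Theta> X Y Z))"

text \<open>The value of \<open>2 g(D X Y, Z)\<close> for a metric connection \<open>D\<close> with torsion \<open>\<Theta>\<close>: the classical Koszul formula with
  \<open>[X, Y] + \<tau>(X, Y)\<close> for every bracket \<open>[X, Y]\<close>.\<close>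

definition koszul :: "('m vfield \<Rightarrow> 'm vfield \<Rightarrow> 'm vfield \<Rightarrow> 'm \<Rightarrow> real) \<Rightarrow>
    'm vfield \<Rightarrow> 'm vfield \<Rightarrow> 'm vfield \<Rightarrow> 'm \<Rightarrow> real" where
  "koszul \<Theta> X Y Z =
     vf_apply X (metric_pair g Y Z) + vf_apply Y (metric_pair g Z X) - vf_apply Z (metric_pair g X Y)
     + bracket_pair X Y Z - bracket_pair Y Z X + bracket_pair Z X Y
     + \<Theta> X Y Z - \<Theta> Y Z X + \<Theta> Z X Y"

text \<open>The constant function allows the Koszul formula to be halved by multiplication in the ring of functions.\<close>

definition half :: "'m \<Rightarrow> real" where "half = (\<lambda>_. 1 / 2)"

lemma half_double: "half * (f + f) = f"
  by (simp add: half_def times_fun_def plus_fun_def)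

lemma half_C_inf: "half \<in> C_inf A"
  by (simp add: half_def)

context
  fixes \<Theta>
  assumes form: "torsion_form \<Theta>"
begin

lemma torsion_form_swap: "X \<in> VF \<Longrightarrow> Y \<in> VF \<Longrightarrow> Z \<in> VF \<Longrightarrow> \<Theta> X Y Z = - \<Theta> Y X Z"
  using form[unfolded torsion_form_def, THEN conjunct1] by blast

lemma torsion_form_linear:
  "X \<in> VF \<Longrightarrow> Y \<in> VF \<Longrightarrow> C_inf_linear (\<Theta> X Y)"
  "Y \<in> VF \<Longrightarrow> Z \<in> VF \<Longrightarrow> C_inf_linear (\<lambda>X. \<Theta> X Y Z)"
  using form[unfolded torsion_form_def, THEN conjunct2] by blast+

lemma torsion_form_C_inf: "X \<in> VF \<Longrightarrow> Y \<in> VF \<Longrightarrow> Z \<in> VF \<Longrightarrow> \<Theta> X Y Z \<in> C_inf A"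
  using torsion_form_linear(1) unfolding C_inf_linear_def by blast

lemma torsion_form_add:
  assumes "X \<in> VF" "Y \<in> VF" "Z \<in> VF" "W \<in> VF"
  shows "\<Theta> (X + W) Y Z = \<Theta> X Y Z + \<Theta> W Y Z"
    and "\<Theta> X (Y + W) Z = \<Theta> X Y Z + \<Theta> X W Z"
    and "\<Theta> X Y (Z + W) = \<Theta> X Y Z + \<Theta> X Y W"
proof -
  have *: "\<Theta> (X + W) Y Z = \<Theta> X Y Z + \<Theta> W Y Z" if "X \<in> VF" "Y \<in> VF" "Z \<in> VF" "W \<in> VF" for X Y Z W
    using torsion_form_linear(2)[OF that(2,3)] that unfolding C_inf_linear_def by blast
  show "\<Theta> (X + W) Y Z = \<Theta> X Y Z + \<Theta> W Y Z" by (rule *[OF assms])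
  show "\<Theta> X (Y + W) Z = \<Theta> X Y Z + \<Theta> X W Z"
    using *[of Y X Z W] torsion_form_swap[of X "Y + W" Z] torsion_form_swap[of X Y Z]
      torsion_form_swap[of X W Z] by (simp add: assms vector_field_add)
  show "\<Theta> X Y (Z + W) = \<Theta> X Y Z + \<Theta> X Y W"
    using torsion_form_linear(1)[OF assms(1,2)] assms unfolding C_inf_linear_def by blast
qed

lemma torsion_form_scale:
  assumes "X \<in> VF" "Y \<in> VF" "Z \<in> VF" "f \<in> C_inf A"
  shows "\<Theta> (f \<odot> X) Y Z = f * \<Theta> X Y Z"
    and "\<Theta> X (f \<odot> Y) Z = f * \<Theta> X Y Z"
    and "\<Theta> X Y (f \<odot> Z) = f * \<Theta> X Y Z"
proof -
  have *: "\<Theta> (f \<odot> X) Y Z = f * \<Theta> X Y Z" if "X \<in> VF" "Y \<in> VF" "Z \<in> VF" for X Y Z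
    using torsion_form_linear(2)[OF that(2,3)] that assms(4) unfolding C_inf_linear_def by blast
  show "\<Theta> (f \<odot> X) Y Z = f * \<Theta> X Y Z" by (rule *[OF assms(1-3)])
  show "\<Theta> X (f \<odot> Y) Z = f * \<Theta> X Y Z"
    using *[of Y X Z] torsion_form_swap[of X "f \<odot> Y" Z] torsion_form_swap[of X Y Z]
    by (simp add: assms vector_field_scale)
  show "\<Theta> X Y (f \<odot> Z) = f * \<Theta> X Y Z"
    using torsion_form_linear(1)[OF assms(1,2)] assms unfolding C_inf_linear_def by blast
qed

lemma koszul_C_inf: "X \<in> VF \<Longrightarrow> Y \<in> VF \<Longrightarrow> Z \<in> VF \<Longrightarrow> koszul \<Theta> X Y Z \<in> C_inf A"
  unfolding koszul_def
  by (intro C_inf_add C_inf_diff vf_apply_C_inf metric_pair_C_inf bracket_pair_C_inf torsion_form_C_inf)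

lemma koszul_add:
  assumes "X \<in> VF" "Y \<in> VF" "Z \<in> VF" "W \<in> VF"
  shows "koszul \<Theta> (X + W) Y Z = koszul \<Theta> X Y Z + koszul \<Theta> W Y Z"
    and "koszul \<Theta> X (Y + W) Z = koszul \<Theta> X Y Z + koszul \<Theta> X W Z"
    and "koszul \<Theta> X Y (Z + W) = koszul \<Theta> X Y Z + koszul \<Theta> X Y W"
  unfolding koszul_def
  by (simp_all add: assms vf_apply_plus metric_pair_add_left metric_pair_add_right vf_apply_add
      metric_pair_C_inf bracket_pair_add torsion_form_add)

text \<open>In the first and third argument the derivatives of \<open>f\<close> cancel between the derivative terms and the bracket
  terms; in the second argument they add up to twice the term of the Leibniz rule.\<close>

lemma koszul_scale:
  assumes "X \<in> VF" "Y \<in> VF" "Z \<in> VF" "f \<in> C_inf A"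
  shows "koszul \<Theta> (f \<odot> X) Y Z = f * koszul \<Theta> X Y Z"
    and "koszul \<Theta> X (f \<odot> Y) Z = f * koszul \<Theta> X Y Z +
      (vf_apply X f * metric_pair g Y Z + vf_apply X f * metric_pair g Y Z)"
    and "koszul \<Theta> X Y (f \<odot> Z) = f * koszul \<Theta> X Y Z"
  unfolding koszul_def
  using metric_pair_sym[OF assms(1,2)] metric_pair_sym[OF assms(1,3)] metric_pair_sym[OF assms(2,3)]
  by (simp_all add: assms vf_apply_scale metric_pair_scale_left metric_pair_scale_right vf_apply_mult
      metric_pair_C_inf bracket_pair_scale torsion_form_scale algebra_simps)

lemma half_koszul_linear:
  assumes "X \<in> VF" "Y \<in> VF"
  shows "C_inf_linear (\<lambda>Z. half * koszul \<Theta> X Y Z)"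
  unfolding C_inf_linear_def
  by (simp add: assms C_inf_mult half_C_inf koszul_C_inf koszul_add(3) koszul_scale(3) algebra_simps)

text \<open>Write out compatibility for the three cyclic permutations of \<open>X, Y, Z\<close> and the torsion for the same
  three permutations, and substitute: all covariant derivatives in the Koszul expression cancel, except
  for \<open>g(D X Y, Z)\<close>, which remains twice.\<close>

lemma connection_koszul:
  assumes D: "affine_connection A D" "metric_compatible A g D"
    and tor: "\<And>X Y Z. X \<in> VF \<Longrightarrow> Y \<in> VF \<Longrightarrow> Z \<in> VF \<Longrightarrow> metric_pair g (torsion D X Y) Z = \<Theta> X Y Z"
    and X: "X \<in> VF" and Y: "Y \<in> VF" and Z: "Z \<in> VF"
  shows "metric_pair g (D X Y) Z = half * koszul \<Theta> X Y Z"
proof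
  fix p
  have DV: "D U V \<in> VF" if "U \<in> VF" "V \<in> VF" for U V
    by (rule affine_connection_vector_field[OF D(1) that])
  have compat: "vf_apply U (metric_pair g V W) p = metric_pair g (D U V) W p + metric_pair g (D U W) V p"
    if "U \<in> VF" "V \<in> VF" "W \<in> VF" for U V W
  proof -
    have "cov_deriv_metric g D U V W p = 0"
      using D(2) that unfolding metric_compatible_def by simp
    then show ?thesis
      by (simp add: cov_deriv_metric_def metric_pair_sym[OF that(2) DV[OF that(1,3)]])
  qed
  have tors: "\<Theta> U V W p = metric_pair g (D U V) W p - metric_pair g (D V U) W p - bracket_pair U V W p"
    if "U \<in> VF" "V \<in> VF" "W \<in> VF" for U V W
    using torsion_pair[OF DV[OF that(1,2)] DV[OF that(2,1)] that, unfolded tor[OF that]] by simp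
  show "metric_pair g (D X Y) Z p = (half * koszul \<Theta> X Y Z) p"
    by (simp add: half_def koszul_def compat[OF X Y Z] compat[OF Y Z X] compat[OF Z X Y]
        tors[OF X Y Z] tors[OF Y Z X] tors[OF Z X Y])
qed

text \<open>Existence: the halved Koszul expression is a \<open>C\<^sup>\<infinity>\<close>-linear functional of \<open>Z\<close> and so is represented by a
  field. All required identities between fields can be tested by pairing with \<open>Z\<close>, where they become
  identities for the Koszul expression. Uniqueness: every such connection is given by this expression.\<close>

theorem ex1_metric_connection_with_torsion:
  "\<exists>!D. affine_connection A D \<and> metric_compatible A g D \<and>
     (\<forall>X\<in>VF. \<forall>Y\<in>VF. \<forall>Z\<in>VF. metric_pair g (torsion D X Y) Z = \<Theta> X Y Z)"
proof (rule ex_ex1I)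
  define D where "D X Y = (if X \<in> VF \<and> Y \<in> VF
      then (SOME W. W \<in> VF \<and> (\<forall>Z\<in>VF. metric_pair g W Z = half * koszul \<Theta> X Y Z)) else 0)" for X Y
  have ex: "D X Y \<in> VF \<and> (\<forall>Z\<in>VF. metric_pair g (D X Y) Z = half * koszul \<Theta> X Y Z)"
    if "X \<in> VF" "Y \<in> VF" for X Y
  proof -
    have "\<exists>W. W \<in> VF \<and> (\<forall>Z\<in>VF. metric_pair g W Z = half * koszul \<Theta> X Y Z)"
      using riesz[OF half_koszul_linear[OF that]] unfolding Bex_def .
    from someI_ex[OF this] show ?thesis using that by (simp add: D_def)
  qed
  have DV: "D X Y \<in> VF" if "X \<in> VF" "Y \<in> VF" for X Y
    using ex[OF that] by (rule conjunct1)
  have G: "metric_pair g (D X Y) Z = half * koszul \<Theta> X Y Z" if "X \<in> VF" "Y \<in> VF" "Z \<in> VF" for X Y Z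
    using ex[OF that(1,2)] that(3) by simp
  have "affine_connection A D"
    unfolding affine_connection_def
  proof (intro conjI ballI allI impI)
    fix X Y Y' f assume X: "X \<in> VF" and Y: "Y \<in> VF" 
    show "D X Y \<in> VF" by (rule DV[OF X Y])
    show "D (X + X') Y = D X Y + D X' Y" if X': "X' \<in> VF" for X'
      by (rule metric_pair_nondegenerate)
        (simp_all add: G metric_pair_add_left koszul_add X X' Y DV vector_field_add algebra_simps)
    show "D X (Y + Y') = D X Y + D X Y'" if Y': "Y' \<in> VF" for Y'
      by (rule metric_pair_nondegenerate)
        (simp_all add: G metric_pair_add_left koszul_add X Y' Y DV vector_field_add algebra_simps)
  next
    fix f X Y assume f: "f \<in> C_inf A" and X: "X \<in> VF" and Y: "Y \<in> VF"
    show "D (f \<odot> X) Y = f \<odot> D X Y"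
      by (rule metric_pair_nondegenerate)
        (simp_all add: G metric_pair_scale_left koszul_scale X Y f DV vector_field_scale mult.left_commute)
    show "D X (f \<odot> Y) = (vf_apply X f \<odot> Y) + (f \<odot> D X Y)"
    proof (rule metric_pair_nondegenerate)
      fix Z assume Z: "Z \<in> VF"
      have "metric_pair g (D X (f \<odot> Y)) Z = half * (f * koszul \<Theta> X Y Z +
          (vf_apply X f * metric_pair g Y Z + vf_apply X f * metric_pair g Y Z))"
        by (simp only: G[OF X vector_field_scale[OF f Y] Z] koszul_scale(2)[OF X Y Z f])
      also have "\<dots> = vf_apply X f * metric_pair g Y Z + f * (half * koszul \<Theta> X Y Z)"
        by (simp only: distrib_left[of half "f * koszul \<Theta> X Y Z"] half_double mult.left_commute[of half f]
            add.commute)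
      also have "\<dots> = metric_pair g ((vf_apply X f \<odot> Y) + (f \<odot> D X Y)) Z"
        by (simp add: G metric_pair_add_left metric_pair_scale_left X Y Z f DV vector_field_scale vf_apply_C_inf)
      finally show "metric_pair g (D X (f \<odot> Y)) Z = metric_pair g ((vf_apply X f \<odot> Y) + (f \<odot> D X Y)) Z" .
    qed (simp_all add: X Y f DV vector_field_scale vector_field_add vf_apply_C_inf)
  next
    fix X Y assume "X \<notin> VF \<or> Y \<notin> VF"
    then show "D X Y = 0" by (auto simp: D_def)
  qed
  moreover have "metric_compatible A g D"
    unfolding metric_compatible_def
  proof (intro ballI)
    fix Z X Y assume Z: "Z \<in> VF" and X: "X \<in> VF" and Y: "Y \<in> VF"
    \<comment> \<open>The part of the Koszul expression that is symmetric in its last two arguments.\<close>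
    have "koszul \<Theta> Z X Y + koszul \<Theta> Z Y X = vf_apply Z (metric_pair g X Y) + vf_apply Z (metric_pair g X Y)"
      unfolding koszul_def
      using metric_pair_sym[OF X Y] metric_pair_sym[OF Y Z] metric_pair_sym[OF Z X]
        bracket_pair_swap[OF X Y Z] bracket_pair_swap[OF Y Z X] bracket_pair_swap[OF Z X Y]
        torsion_form_swap[OF X Y Z] torsion_form_swap[OF Y Z X] torsion_form_swap[OF Z X Y]
      by (simp add: algebra_simps)
    then have "half * koszul \<Theta> Z X Y + half * koszul \<Theta> Z Y X = vf_apply Z (metric_pair g X Y)"
      by (simp only: half_double flip: ring_distribs(1))
    then show "cov_deriv_metric g D Z X Y = 0"
      by (simp add: cov_deriv_metric_def G X Y Z metric_pair_sym[OF X DV[OF Z Y]] algebra_simps)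
  qed
  moreover have "metric_pair g (torsion D X Y) Z = \<Theta> X Y Z"
    if X: "X \<in> VF" and Y: "Y \<in> VF" and Z: "Z \<in> VF" for X Y Z
  proof -
    \<comment> \<open>The part of the Koszul expression that is antisymmetric in its first two arguments.\<close>
    have "koszul \<Theta> X Y Z - koszul \<Theta> Y X Z = (bracket_pair X Y Z + \<Theta> X Y Z) + (bracket_pair X Y Z + \<Theta> X Y Z)"
      unfolding koszul_def
      using metric_pair_sym[OF X Y] metric_pair_sym[OF Y Z] metric_pair_sym[OF Z X]
        bracket_pair_swap[OF X Y Z] bracket_pair_swap[OF Y Z X] bracket_pair_swap[OF Z X Y]
        torsion_form_swap[OF X Y Z] torsion_form_swap[OF Y Z X] torsion_form_swap[OF Z X Y]
      by (simp add: algebra_simps)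
    then have "half * koszul \<Theta> X Y Z - half * koszul \<Theta> Y X Z = bracket_pair X Y Z + \<Theta> X Y Z"
      by (simp only: half_double flip: right_diff_distrib)
    then show ?thesis
      by (simp add: torsion_pair DV X Y Z G)
  qed
  ultimately show "\<exists>D. affine_connection A D \<and> metric_compatible A g D \<and>
     (\<forall>X\<in>VF. \<forall>Y\<in>VF. \<forall>Z\<in>VF. metric_pair g (torsion D X Y) Z = \<Theta> X Y Z)"
    by (intro exI[of _ D]) simp
next
  fix D D'
  assume D: "affine_connection A D \<and> metric_compatible A g D \<and>
     (\<forall>X\<in>VF. \<forall>Y\<in>VF. \<forall>Z\<in>VF. metric_pair g (torsion D X Y) Z = \<Theta> X Y Z)"
    and D': "affine_connection A D' \<and> metric_compatible A g D' \<and>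
     (\<forall>X\<in>VF. \<forall>Y\<in>VF. \<forall>Z\<in>VF. metric_pair g (torsion D' X Y) Z = \<Theta> X Y Z)"
  show "D = D'"
  proof (intro ext[of D D'] ext[of "D _" "D' _"])
    fix X Y
    show "D X Y = D' X Y"
    proof (cases "X \<in> VF \<and> Y \<in> VF")
      case True
      then have XY: "X \<in> VF" "Y \<in> VF" by auto
      show ?thesis
      proof (rule metric_pair_nondegenerate)
        show "D X Y \<in> VF" "D' X Y \<in> VF"
          using D D' XY by (simp_all add: affine_connection_vector_field)
        show "metric_pair g (D X Y) Z = metric_pair g (D' X Y) Z" if "Z \<in> VF" for Z
          using connection_koszul[of D X Y Z] connection_koszul[of D' X Y Z] D D' XY that by simp
      qed
    next
      case False
      then have "D X Y = 0" "D' X Y = 0"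
        using D D' unfolding affine_connection_def by simp_all
      then show ?thesis by simp
    qed
  qed
qed

end

section \<open>The torsion determined by a distribution\<close>

lemma lie_deriv_metric_eq:
  assumes "X \<in> VF" "Y \<in> VF" "Z \<in> VF"
  shows "lie_deriv_metric g Z X Y =
    vf_apply Z (metric_pair g X Y) - bracket_pair Z X Y - bracket_pair Z Y X"
  unfolding lie_deriv_metric_def bracket_pair_def
  using metric_pair_sym[OF assms(1) lie_bracket_vector_field[OF assms(3,2)]] by simp

lemma lie_deriv_metric_C_inf:
  "X \<in> VF \<Longrightarrow> Y \<in> VF \<Longrightarrow> Z \<in> VF \<Longrightarrow> lie_deriv_metric g Z X Y \<in> C_inf A"
  by (simp add: lie_deriv_metric_eq C_inf_diff vf_apply_C_inf metric_pair_C_inf bracket_pair_C_inf)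

lemma lie_deriv_metric_add:
  assumes "X \<in> VF" "Y \<in> VF" "Z \<in> VF" "W \<in> VF"
  shows "lie_deriv_metric g (Z + W) X Y = lie_deriv_metric g Z X Y + lie_deriv_metric g W X Y"
    and "lie_deriv_metric g Z (X + W) Y = lie_deriv_metric g Z X Y + lie_deriv_metric g Z W Y"
    and "lie_deriv_metric g Z X (Y + W) = lie_deriv_metric g Z X Y + lie_deriv_metric g Z X W"
  by (simp_all add: assms lie_deriv_metric_eq vector_field_add vf_apply_plus vf_apply_add metric_pair_C_inf
      metric_pair_add_left metric_pair_add_right bracket_pair_add)

text \<open>The Lie derivative is tensorial in the last two arguments, but in the direction \<open>Z\<close> only up to terms with
  \<open>g(Z, X)\<close> and \<open>g(Z, Y)\<close>.\<close>

lemma lie_deriv_metric_scale: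
  assumes "X \<in> VF" "Y \<in> VF" "Z \<in> VF" "f \<in> C_inf A"
  shows "lie_deriv_metric g (f \<odot> Z) X Y = f * lie_deriv_metric g Z X Y
      + vf_apply X f * metric_pair g Z Y + vf_apply Y f * metric_pair g Z X"
    and "lie_deriv_metric g Z (f \<odot> X) Y = f * lie_deriv_metric g Z X Y"
    and "lie_deriv_metric g Z X (f \<odot> Y) = f * lie_deriv_metric g Z X Y"
  using metric_pair_sym[OF assms(1,2)]
  by (simp_all add: assms lie_deriv_metric_eq vector_field_scale vf_apply_scale vf_apply_mult metric_pair_C_inf
      metric_pair_scale_left metric_pair_scale_right bracket_pair_scale algebra_simps)

end

locale riemannian_distribution = riemannian_manifold A g
  for A :: "('m::{t2_space, second_countable_topology}, 'e::euclidean_space) atlas"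
    and g :: "'m metric_tensor" +
  fixes E :: "'m \<Rightarrow> 'm tvec set" and r :: nat
  assumes dist: "distribution A r E"
begin

abbreviation tangential :: "'m vfield set" where "tangential \<equiv> sections A E"
abbreviation normal :: "'m vfield set" where "normal \<equiv> sections A (orth_complement A g E)"

definition tpart :: "'m vfield \<Rightarrow> 'm vfield" where "tpart X = proj E X"
definition npart :: "'m vfield \<Rightarrow> 'm vfield" where "npart X = X - tpart X"

lemma tpart_plus_npart: "tpart X + npart X = X"
  by (simp add: npart_def)

lemma tangential_VF: "X \<in> tangential \<Longrightarrow> X \<in> VF"
  using distribution_tangent[OF dist] unfolding sections_def local_sections_def by blast

lemma normal_VF: "X \<in> normal \<Longrightarrow> X \<in> VF"
  unfolding sections_def local_sections_def orth_complement_def by blast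

lemma sections_mem: "X \<in> sections A F \<Longrightarrow> X p \<in> F p"
  unfolding sections_def local_sections_def by blast

lemma sectionsI: "X \<in> VF \<Longrightarrow> (\<And>p. X p \<in> F p) \<Longrightarrow> X \<in> sections A F"
  unfolding sections_def local_sections_def by blast

lemma normalI:
  assumes "X \<in> VF" "\<And>p u. u \<in> E p \<Longrightarrow> g p (X p) u = 0"
  shows "X \<in> normal"
  by (rule sectionsI) (use assms vector_field_tangent in \<open>auto simp: orth_complement_def\<close>)

lemma normalD: "\<xi> \<in> normal \<Longrightarrow> u \<in> E p \<Longrightarrow> g p (\<xi> p) u = 0"
  using sections_mem[of \<xi> "orth_complement A g E" p] by (simp add: orth_complement_def)

lemma E_tangent: "u \<in> E p \<Longrightarrow> u \<in> T p"
  using distribution_tangent[OF dist] by blast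

lemma tangential_normal: "X \<in> tangential \<Longrightarrow> \<xi> \<in> normal \<Longrightarrow> metric_pair g \<xi> X = 0"
  by (rule ext) (simp add: metric_pair_def normalD sections_mem)

lemma normal_tangential: "X \<in> tangential \<Longrightarrow> \<xi> \<in> normal \<Longrightarrow> metric_pair g X \<xi> = 0"
  using tangential_normal metric_pair_sym tangential_VF normal_VF by metis

lemma tpart_tangential: "X \<in> VF \<Longrightarrow> tpart X \<in> tangential"
  unfolding tpart_def by (rule proj_section[OF dist])

text \<open>Recognises the component along \<open>E\<close> without a frame; linearity of both components follows from it.\<close>

lemma tpart_eqI:
  assumes "X \<in> VF" "Y \<in> tangential" "X - Y \<in> normal"
  shows "tpart X = Y"
proof
  fix p
  show "tpart X p = Y p"
    unfolding tpart_def
  proof (rule proj_eqI[OF dist vector_field_tangent[OF assms(1)] sections_mem[OF assms(2)]])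
    show "g p (X p - Y p) u = 0" if "u \<in> E p" for u
      using sections_mem[OF assms(3), of p] that by (simp add: orth_complement_def)
  qed
qed

lemma npart_normal:
  assumes "X \<in> VF"
  shows "npart X \<in> normal"
proof (rule sectionsI)
  show V: "npart X \<in> VF"
    unfolding npart_def by (intro vector_field_diff assms tangential_VF tpart_tangential)
  fix p
  have "g p (X p - tpart X p) u = 0" if "u \<in> E p" for u
  proof -
    obtain U e where U: "open U" "p \<in> U"
      and ob: "\<And>q. q \<in> U \<Longrightarrow> orthogonal_basis q r (\<lambda>i. e i q) (E q)"
      by (rule orthogonal_frame[OF dist]) (rule that)
    have "tpart X p = fourier p r (\<lambda>i. e i p) (X p)"
      unfolding tpart_def using ob[OF U(2)] vector_field_tangent[OF assms] by (rule proj_fourier[OF dist])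
    then show ?thesis
      using fourier_orthogonal[OF ob[OF U(2)] vector_field_tangent[OF assms] that] by simp
  qed
  then show "npart X p \<in> orth_complement A g E p"
    using vector_field_tangent[OF V, of p] by (simp add: orth_complement_def npart_def)
qed

lemmas tpart_VF = tangential_VF[OF tpart_tangential]
lemmas npart_VF = normal_VF[OF npart_normal]

lemma tangential_add: "X \<in> tangential \<Longrightarrow> Y \<in> tangential \<Longrightarrow> X + Y \<in> tangential"
  by (rule sectionsI) (auto intro: vector_field_add tangential_VF subspace_add[OF distribution_subspace[OF dist]] sections_mem)

lemma tangential_scale: "f \<in> C_inf A \<Longrightarrow> X \<in> tangential \<Longrightarrow> f \<odot> X \<in> tangential"
  by (rule sectionsI)
    (auto simp: vf_scale_def[of f X] intro: vector_field_scale[of f X, unfolded vf_scale_def] tangential_VF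
      subspace_scale[OF distribution_subspace[OF dist]] sections_mem)

lemma normal_add: "\<xi> \<in> normal \<Longrightarrow> \<eta> \<in> normal \<Longrightarrow> \<xi> + \<eta> \<in> normal"
  by (rule normalI)
    (simp_all add: vector_field_add normal_VF g_add_left vector_field_tangent E_tangent normalD)

lemma normal_scale: "f \<in> C_inf A \<Longrightarrow> \<xi> \<in> normal \<Longrightarrow> f \<odot> \<xi> \<in> normal"
  by (rule normalI, simp add: vector_field_scale normal_VF)
    (simp add: vf_scale_def g_scale_left vector_field_tangent normal_VF E_tangent normalD)

lemma tpart_add:
  assumes "X \<in> VF" "Y \<in> VF"
  shows "tpart (X + Y) = tpart X + tpart Y"
proof (rule tpart_eqI)
  have "X + Y - (tpart X + tpart Y) = npart X + npart Y" by (simp add: npart_def)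
  then show "X + Y - (tpart X + tpart Y) \<in> normal" using npart_normal assms normal_add by simp
qed (use assms in \<open>auto intro: vector_field_add tangential_add tpart_tangential\<close>)

lemma vf_scale_diff: "f \<odot> (X - Y) = f \<odot> X - f \<odot> Y"
  by (rule ext) (simp add: vf_scale_def scaleR_diff_right)

lemma tpart_scale:
  assumes "f \<in> C_inf A" "X \<in> VF"
  shows "tpart (f \<odot> X) = f \<odot> tpart X"
proof (rule tpart_eqI)
  show "f \<odot> X - f \<odot> tpart X \<in> normal"
    using normal_scale[OF assms(1) npart_normal[OF assms(2)]] by (simp add: npart_def vf_scale_diff)
qed (use assms in \<open>auto intro: vector_field_scale tangential_scale tpart_tangential\<close>)

lemma npart_add: "X \<in> VF \<Longrightarrow> Y \<in> VF \<Longrightarrow> npart (X + Y) = npart X + npart Y"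
  by (simp add: npart_def tpart_add)

lemma npart_scale: "f \<in> C_inf A \<Longrightarrow> X \<in> VF \<Longrightarrow> npart (f \<odot> X) = f \<odot> npart X"
  by (simp add: npart_def tpart_scale vf_scale_diff)

lemma zero_normal: "0 \<in> normal"
  by (rule normalI[OF vector_field_0]) (simp add: g_zero_left E_tangent)

lemma zero_tangential: "0 \<in> tangential"
  by (rule sectionsI[OF vector_field_0]) (simp add: subspace_0[OF distribution_subspace[OF dist]])

lemma tpart_of_tangential: "X \<in> tangential \<Longrightarrow> tpart X = X"
  by (rule tpart_eqI) (simp_all add: tangential_VF zero_normal)

lemma tpart_of_normal: "\<xi> \<in> normal \<Longrightarrow> tpart \<xi> = 0"
  by (rule tpart_eqI) (simp_all add: normal_VF zero_tangential)

lemma npart_of_tangential: "X \<in> tangential \<Longrightarrow> npart X = 0"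
  by (simp add: npart_def tpart_of_tangential)

lemma npart_of_normal: "\<xi> \<in> normal \<Longrightarrow> npart \<xi> = \<xi>"
  by (simp add: npart_def tpart_of_normal)

text \<open>The value that the conditions on the torsion force on \<open>g(\<tau>(\<xi>, X), Z)\<close> for normal \<open>\<xi>\<close> and tangential \<open>X\<close>: the
  one with \<open>L\<^sub>\<xi> g\<close> deals with the component of \<open>Z\<close> along \<open>E\<close>, the one with \<open>L\<^sub>X g\<close> with the normal one.\<close>

definition mixed_torsion :: "'m vfield \<Rightarrow> 'm vfield \<Rightarrow> 'm vfield \<Rightarrow> 'm \<Rightarrow> real" where
  "mixed_torsion \<xi> X Z = half * (lie_deriv_metric g \<xi> X (tpart Z) - lie_deriv_metric g X \<xi> (npart Z))"

text \<open>The torsion is required to vanish on two tangential and on two normal arguments. The values on mixed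
  arguments in the two orders are related by antisymmetry of \<open>\<tau>\<close>, hence the minus sign.\<close>

definition distribution_torsion :: "'m vfield \<Rightarrow> 'm vfield \<Rightarrow> 'm vfield \<Rightarrow> 'm \<Rightarrow> real" where
  "distribution_torsion X Y Z = mixed_torsion (npart X) (tpart Y) Z - mixed_torsion (npart Y) (tpart X) Z"

lemma mixed_torsion_C_inf: "\<xi> \<in> normal \<Longrightarrow> X \<in> tangential \<Longrightarrow> Z \<in> VF \<Longrightarrow> mixed_torsion \<xi> X Z \<in> C_inf A"
  unfolding mixed_torsion_def
  by (simp add: C_inf_mult half_C_inf C_inf_diff lie_deriv_metric_C_inf tpart_VF npart_VF tangential_VF normal_VF)

lemma mixed_torsion_add:
  assumes "\<xi> \<in> normal" "X \<in> tangential" "Z \<in> VF"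
  shows "\<eta> \<in> normal \<Longrightarrow> mixed_torsion (\<xi> + \<eta>) X Z = mixed_torsion \<xi> X Z + mixed_torsion \<eta> X Z"
    and "Y \<in> tangential \<Longrightarrow> mixed_torsion \<xi> (X + Y) Z = mixed_torsion \<xi> X Z + mixed_torsion \<xi> Y Z"
    and "W \<in> VF \<Longrightarrow> mixed_torsion \<xi> X (Z + W) = mixed_torsion \<xi> X Z + mixed_torsion \<xi> X W"
  by (simp_all add: mixed_torsion_def assms lie_deriv_metric_add tpart_add npart_add tpart_VF npart_VF tangential_VF normal_VF
      algebra_simps)

text \<open>In the two Lie derivatives the direction is orthogonal to both other arguments, so that the
  non-tensorial terms of \<open>lie_deriv_metric_scale\<close> vanish.\<close>

lemma mixed_torsion_scale:
  assumes "\<xi> \<in> normal" "X \<in> tangential" "Z \<in> VF" "f \<in> C_inf A"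
  shows "mixed_torsion (f \<odot> \<xi>) X Z = f * mixed_torsion \<xi> X Z"
    and "mixed_torsion \<xi> (f \<odot> X) Z = f * mixed_torsion \<xi> X Z"
    and "mixed_torsion \<xi> X (f \<odot> Z) = f * mixed_torsion \<xi> X Z"
  by (simp_all add: mixed_torsion_def assms lie_deriv_metric_scale tpart_scale npart_scale tpart_VF npart_VF tangential_VF normal_VF
      tangential_normal normal_tangential tpart_tangential npart_normal algebra_simps)

lemma mixed_torsion_0: "X \<in> tangential \<Longrightarrow> Z \<in> VF \<Longrightarrow> mixed_torsion 0 X Z = 0"
    "\<xi> \<in> normal \<Longrightarrow> Z \<in> VF \<Longrightarrow> mixed_torsion \<xi> 0 Z = 0"
  using mixed_torsion_add(1)[of 0 X Z 0] mixed_torsion_add(2)[of \<xi> 0 Z 0] zero_normal zero_tangential by simp_all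

lemma torsion_form_distribution_torsion: "torsion_form distribution_torsion"
  unfolding torsion_form_def
proof (intro conjI ballI)
  fix X Y assume X: "X \<in> VF" and Y: "Y \<in> VF"
  show "distribution_torsion X Y Z = - distribution_torsion Y X Z" for Z by (simp add: distribution_torsion_def)
  show "C_inf_linear (distribution_torsion X Y)"
    unfolding C_inf_linear_def distribution_torsion_def
    by (simp add: X Y tpart_tangential npart_normal mixed_torsion_add mixed_torsion_scale C_inf_diff mixed_torsion_C_inf algebra_simps)
  show "C_inf_linear (\<lambda>Z. distribution_torsion Z X Y)"
    unfolding C_inf_linear_def distribution_torsion_def
    by (simp add: X Y tpart_tangential npart_normal tpart_add npart_add tpart_scale npart_scale tangential_add normal_add
        mixed_torsion_add mixed_torsion_scale C_inf_diff mixed_torsion_C_inf algebra_simps)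
qed

lemma torsion_pair_add:
  assumes "affine_connection A D" "X \<in> VF" "Y \<in> VF" "Z \<in> VF" "W \<in> VF"
  shows "metric_pair g (torsion D (X + W) Y) Z = metric_pair g (torsion D X Y) Z + metric_pair g (torsion D W Y) Z"
    and "metric_pair g (torsion D X (Y + W)) Z = metric_pair g (torsion D X Y) Z + metric_pair g (torsion D X W) Z"
proof -
  have "D (X + W) Y = D X Y + D W Y" "D Y (X + W) = D Y X + D Y W"
    "D (Y + W) X = D Y X + D W X" "D X (Y + W) = D X Y + D X W"
    using assms unfolding affine_connection_def by simp_all
  then show "metric_pair g (torsion D (X + W) Y) Z = metric_pair g (torsion D X Y) Z + metric_pair g (torsion D W Y) Z"
    "metric_pair g (torsion D X (Y + W)) Z = metric_pair g (torsion D X Y) Z + metric_pair g (torsion D X W) Z"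
    by (simp_all add: torsion_pair assms affine_connection_vector_field vector_field_add metric_pair_add_left
        bracket_pair_add)
qed

lemma torsion_pair_swap:
  assumes "affine_connection A D" "X \<in> VF" "Y \<in> VF" "Z \<in> VF"
  shows "metric_pair g (torsion D X Y) Z = - metric_pair g (torsion D Y X) Z"
  using bracket_pair_swap[OF assms(2,3,4)]
  by (simp add: torsion_pair assms affine_connection_vector_field)

text \<open>From left to right, expand all three arguments into tangential and normal parts. From right to
  left, insert fields of pure type, for which at most one term of \<open>distribution_torsion\<close> survives.\<close>

lemma torsion_conditions_iff:
  assumes D: "affine_connection A D"
  shows "(\<forall>X\<in>tangential. \<forall>Y\<in>tangential. torsion D X Y = 0) \<and>
     (\<forall>\<xi>\<in>normal. \<forall>\<eta>\<in>normal. torsion D \<xi> \<eta> = 0) \<and>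
     (\<forall>\<xi>\<in>normal. \<forall>X\<in>tangential. \<forall>Y\<in>tangential.
        metric_pair g (torsion D \<xi> X) Y = (1/2) *\<^sub>R lie_deriv_metric g \<xi> X Y) \<and>
     (\<forall>\<xi>\<in>normal. \<forall>\<eta>\<in>normal. \<forall>X\<in>tangential.
        metric_pair g (torsion D \<xi> X) \<eta> = - (1/2) *\<^sub>R lie_deriv_metric g X \<xi> \<eta>) \<longleftrightarrow>
     (\<forall>X\<in>VF. \<forall>Y\<in>VF. \<forall>Z\<in>VF. metric_pair g (torsion D X Y) Z = distribution_torsion X Y Z)" (is "?L \<longleftrightarrow> ?R")
proof -
  have half: "(1/2) *\<^sub>R f = half * f" "- (1/2) *\<^sub>R f = - (half * f)" for f :: "'m \<Rightarrow> real"
    by (rule ext, simp add: half_def scaleR_fun_apply)+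
  let ?t = "\<lambda>X Y Z. metric_pair g (torsion D X Y) Z"
  have tV: "torsion D X Y \<in> VF" if "X \<in> VF" "Y \<in> VF" for X Y
    using affine_connection_vector_field[OF D] that by (intro torsion_vector_field)
  show ?thesis
  proof
    assume L: ?L
    show ?R
    proof (intro ballI)
      fix X Y Z assume X: "X \<in> VF" and Y: "Y \<in> VF" and Z: "Z \<in> VF"
      have mixed_torsion: "?t \<xi> V Z = mixed_torsion \<xi> V Z" if "\<xi> \<in> normal" "V \<in> tangential" for \<xi> V
      proof -
        have "?t \<xi> V Z = ?t \<xi> V (tpart Z) + ?t \<xi> V (npart Z)"
          using metric_pair_add_right[OF tpart_VF[OF Z] npart_VF[OF Z] tV[OF normal_VF tangential_VF]] that
          by (simp only: tpart_plus_npart)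
        also have "?t \<xi> V (tpart Z) = half * lie_deriv_metric g \<xi> V (tpart Z)"
          using L that tpart_tangential[OF Z] by (simp only: half)
        also have "?t \<xi> V (npart Z) = - (half * lie_deriv_metric g V \<xi> (npart Z))"
          using L that npart_normal[OF Z] by (simp only: half)
        finally show ?thesis by (simp only: mixed_torsion_def right_diff_distrib add_uminus_conv_diff)
      qed
      have PP: "torsion D (tpart X) (tpart Y) = 0" "torsion D (npart X) (npart Y) = 0"
        using L X Y tpart_tangential npart_normal by blast+
      have "?t X Y Z = ?t (tpart X + npart X) (tpart Y + npart Y) Z" by (simp only: tpart_plus_npart)
      also have "\<dots> = ?t (tpart X) (npart Y) Z + ?t (npart X) (tpart Y) Z"
        by (simp add: torsion_pair_add[OF D] X Y Z tpart_VF npart_VF vector_field_add PP metric_pair_0_left)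
      also have "?t (tpart X) (npart Y) Z = - ?t (npart Y) (tpart X) Z"
        by (intro torsion_pair_swap D tpart_VF npart_VF X Y Z)
      also have "- ?t (npart Y) (tpart X) Z + ?t (npart X) (tpart Y) Z = distribution_torsion X Y Z"
        by (simp add: distribution_torsion_def mixed_torsion tpart_tangential npart_normal X Y)
      finally show "?t X Y Z = distribution_torsion X Y Z" .
    qed
  next
    assume R: ?R
    have torsion_eq: "?t X Y Z = distribution_torsion X Y Z" if "X \<in> VF" "Y \<in> VF" "Z \<in> VF" for X Y Z
      using R that by blast
    have zero: "torsion D X Y = 0" if "X \<in> VF" "Y \<in> VF" "\<And>Z. Z \<in> VF \<Longrightarrow> distribution_torsion X Y Z = 0" for X Y
      by (rule metric_pair_nondegenerate[OF tV[OF that(1,2)] vector_field_0])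
        (simp add: torsion_eq that metric_pair_0_left)
    have mixed_torsion: "?t \<xi> X Z = mixed_torsion \<xi> X Z" if "\<xi> \<in> normal" "X \<in> tangential" "Z \<in> VF" for \<xi> X Z
      by (simp add: torsion_eq distribution_torsion_def that normal_VF tangential_VF tpart_of_tangential tpart_of_normal npart_of_tangential
          npart_of_normal mixed_torsion_0 zero_normal zero_tangential)
    have lie0: "lie_deriv_metric g Z X 0 = 0" if "X \<in> VF" "Z \<in> VF" for X Z
      using lie_deriv_metric_add(3)[OF that(1) vector_field_0 that(2) vector_field_0] by simp
    show ?L
    proof (intro conjI ballI)
      fix X Y assume "X \<in> tangential" "Y \<in> tangential"
      then show "torsion D X Y = 0"
        by (intro zero) (simp_all add: tangential_VF distribution_torsion_def npart_of_tangential tpart_tangential mixed_torsion_0)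
    next
      fix \<xi> \<eta> assume "\<xi> \<in> normal" "\<eta> \<in> normal"
      then show "torsion D \<xi> \<eta> = 0"
        by (intro zero) (simp_all add: normal_VF distribution_torsion_def tpart_of_normal npart_normal mixed_torsion_0)
    next
      fix \<xi> X Y assume "\<xi> \<in> normal" "X \<in> tangential" "Y \<in> tangential"
      then show "?t \<xi> X Y = (1/2) *\<^sub>R lie_deriv_metric g \<xi> X Y"
        unfolding half
        by (simp add: mixed_torsion mixed_torsion_def tangential_VF normal_VF tpart_of_tangential npart_of_tangential lie0)
    next
      fix \<xi> \<eta> X assume "\<xi> \<in> normal" "\<eta> \<in> normal" "X \<in> tangential"
      then show "?t \<xi> X \<eta> = - (1/2) *\<^sub>R lie_deriv_metric g X \<xi> \<eta>"
        unfolding half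
        by (simp add: mixed_torsion mixed_torsion_def tangential_VF normal_VF tpart_of_normal npart_of_normal lie0)
    qed
  qed
qed

end

theorem theorem1p2:
  fixes A :: "('m::{t2_space, second_countable_topology}, 'e::euclidean_space) atlas"
    and g :: "'m metric_tensor"
    and E :: "'m \<Rightarrow> 'm tvec set"
    and r :: nat
  assumes "smooth_atlas A"
    and "riemannian_metric A g"
    and "distribution A r E"
  shows "\<exists>!D. affine_connection A D \<and> metric_compatible A g D \<and>
     (\<forall>X\<in>sections A E. \<forall>Y\<in>sections A E. torsion D X Y = 0) \<and>
     (\<forall>\<xi>\<in>sections A (orth_complement A g E). \<forall>\<eta>\<in>sections A (orth_complement A g E).
        torsion D \<xi> \<eta> = 0) \<and>
     (\<forall>\<xi>\<in>sections A (orth_complement A g E). \<forall>X\<in>sections A E. \<forall>Y\<in>sections A E.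
        metric_pair g (torsion D \<xi> X) Y = (1/2) *\<^sub>R lie_deriv_metric g \<xi> X Y) \<and>
     (\<forall>\<xi>\<in>sections A (orth_complement A g E). \<forall>\<eta>\<in>sections A (orth_complement A g E).
      \<forall>X\<in>sections A E.
        metric_pair g (torsion D \<xi> X) \<eta> = - (1/2) *\<^sub>R lie_deriv_metric g X \<xi> \<eta>)"
proof -
  interpret riemannian_distribution A g E r
    by unfold_locales (fact assms)+
  show ?thesis
    using ex1_metric_connection_with_torsion[OF torsion_form_distribution_torsion]
    by (simp only: torsion_conditions_iff cong: conj_cong)
qed

end
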